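(* Let $n\ge 1$. There is a bijection between the set of fully tiered trees of weight $0$ on the vertex set $\{1,\dots,n\}$ and the set of complete nonambiguous trees with $n-1$ internal vertices.
   Context: A fully tiered tree on $\{1,\dots,n\}$ is a tree $T$ on that vertex set together with a bijection $t\colon\{1,\dots,n\}\to\{1,\dots,n\}$ (the tiering function) such that whenever $v,v'$ are adjacent and $v>v'$ we have $t(v)>t(v')$. The weight $w(T)$ of a tree with integer vertex labels and tiering function $t$ (satisfying the same adjacency condition) is defined recursively: if $T$ has one vertex, $w(T)=0$; otherwise let $v$ be the vertex with smallest label, $T_1,\dots,T_l$ the components after deleting $v$ (with restricted labels and tiering), $u_i\in T_i$ the neighbor of $v$ in $T_i$, and $w_i$ the number of $u\in T_i$ with $t(u)>t(v)$ and $u<u_i$; then $w(T)=\sum_{i=1}^l (w_i+w(T_i))$. A nonambiguous tree is a finite set $A\subset \mathbb Z_{>0}\times\mathbb Z_{>0}$, writing $p=(X(p),Y(p))$, such that: (1) $(1,1)\in A$ (the root); (2) for every $p\in A$ other than the root, either there is some $q\in A$ with $Y(q)=Y(p)$ and $X(q)<X(p)$, or there is some $q\in A$ with $X(q)=X(p)$ and $Y(q)<Y(p)$, but not both; (3) no empty lines: if some point of $A$ has $X$-coordinate $x$ (resp. $Y$-coordinate $y$), then for every $x'<x$ (resp. $y'<y$) some point of $A$ has $X$-coordinate $x'$ (resp. $Y$-coordinate $y'$). Such $A$ is a binary tree in which the parent of a non-root point $p$ is the nearest point of $A$ preceding $p$ in its row (smaller $X$, same $Y$) or in its column (same $X$,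 smaller $Y$). It is complete if every point has $0$ or $2$ children; internal vertices are those with children. *)

theory Defs
  imports Main "HOL-Combinatorics.Permutations"
begin

text \<open>A graph on a vertex set \<open>V\<close> is given by its set \<open>E\<close> of edges, each edge being a
  two-element set of vertices.\<close>

definition adj_on :: "'a set \<Rightarrow> 'a set set \<Rightarrow> ('a \<times> 'a) set" where
  "adj_on V E = {(u, v). u \<in> V \<and> v \<in> V \<and> {u, v} \<in> E}"

text \<open>Vertex sets of the connected components of the subgraph induced by \<open>E\<close> on \<open>V\<close>.
  The closure is also reflexive outside \<open>V\<close>; this does not matter, since the quotient
  consists of the classes of the elements of \<open>V\<close> only.\<close>

definition components :: "'a set \<Rightarrow> 'a set set \<Rightarrow> 'a set set" where
  "components V E = V // (adj_on V E)\<^sup>*"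

definition is_cycle :: "'a set set \<Rightarrow> 'a list \<Rightarrow> bool" where
  "is_cycle E vs \<longleftrightarrow> length vs \<ge> 3 \<and> distinct vs \<and>
     (\<forall>i < length vs. {vs ! i, vs ! (Suc i mod length vs)} \<in> E)"

definition is_tree :: "'a set \<Rightarrow> 'a set set \<Rightarrow> bool" where
  "is_tree V E \<longleftrightarrow> finite V \<and> V \<noteq> {} \<and> (\<forall>e \<in> E. e \<subseteq> V \<and> card e = 2) \<and>
     (\<forall>u \<in> V. \<forall>v \<in> V. (u, v) \<in> (adj_on V E)\<^sup>*) \<and> (\<nexists>vs. is_cycle E vs)"

text \<open>A permutation of \<open>{1..n}\<close> in the sense of \<open>permutes\<close> is the identity outside
  \<open>{1..n}\<close>, so distinct functions \<open>t\<close> below are distinct tiering functions.\<close>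

definition fully_tiered_tree :: "nat \<Rightarrow> nat set set \<Rightarrow> (nat \<Rightarrow> nat) \<Rightarrow> bool" where
  "fully_tiered_tree n E t \<longleftrightarrow> is_tree {1..n} E \<and> t permutes {1..n} \<and>
     (\<forall>u v. {u, v} \<in> E \<and> u > v \<longrightarrow> t u > t v)"

lemma components_subset: "C \<in> components V E \<Longrightarrow> C \<subseteq> V"
proof
  fix y assume "C \<in> components V E" and y: "y \<in> C"
  then obtain x where "x \<in> V" "(x, y) \<in> (adj_on V E)\<^sup>*"
    by (auto simp: components_def quotient_def)
  from this(2,1) show "y \<in> V"
    by (induction rule: rtrancl_induct) (auto simp: adj_on_def)
qed

text \<open>Weight of the subtree induced by the edges \<open>E\<close> and the labels \<open>t\<close> on the vertex
  set \<open>V\<close>.  The value is only meaningful if this induced subgraph is a tree; in that case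
  every component \<open>C\<close> contains exactly one neighbour of the deleted vertex.\<close>

function weight :: "nat set set \<Rightarrow> (nat \<Rightarrow> nat) \<Rightarrow> nat set \<Rightarrow> nat" where
  "weight E t V =
     (if finite V \<and> card V > 1 then
        let v = Min V in
        \<Sum>C \<in> components (V - {v}) E.
          card {u \<in> C. t u > t v \<and> u < (THE u'. u' \<in> C \<and> {v, u'} \<in> E)} + weight E t C
      else 0)"
  by pat_completeness auto
termination
proof (relation "Wellfounded.measure (\<lambda>(E, t, V). card V)", goal_cases)
  case 1
  show ?case by simp
next
  case (2 E t V v C)
  then have "finite V" "V \<noteq> {}" by auto
  with 2(2) have "v \<in> V" by simp
  moreover have "C \<subseteq> V - {v}" using 2(3) by (rule components_subset)
  ultimately have "C \<subset> V" by blast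
  with \<open>finite V\<close> show ?case by (simp add: psubset_card_mono)
qed

declare weight.simps [simp del]

text \<open>A point \<open>p\<close> has \<open>X\<close>-coordinate \<open>fst p\<close> and \<open>Y\<close>-coordinate \<open>snd p\<close>.\<close>

definition row_before :: "(nat \<times> nat) set \<Rightarrow> nat \<times> nat \<Rightarrow> (nat \<times> nat) set" where
  "row_before A p = {q \<in> A. snd q = snd p \<and> fst q < fst p}"

definition col_before :: "(nat \<times> nat) set \<Rightarrow> nat \<times> nat \<Rightarrow> (nat \<times> nat) set" where
  "col_before A p = {q \<in> A. fst q = fst p \<and> snd q < snd p}"

text \<open>In the second line, inequality of the two truth values is exclusive disjunction.\<close>

definition nonambiguous_tree :: "(nat \<times> nat) set \<Rightarrow> bool" where
  "nonambiguous_tree A \<longleftrightarrow> finite A \<and> (\<forall>p \<in> A. fst p > 0 \<and> snd p > 0) \<and> (1, 1) \<in> A \<and>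
     (\<forall>p \<in> A. p \<noteq> (1, 1) \<longrightarrow> (row_before A p \<noteq> {}) \<noteq> (col_before A p \<noteq> {})) \<and>
     (\<forall>p \<in> A. \<forall>x. 0 < x \<and> x < fst p \<longrightarrow> (\<exists>q \<in> A. fst q = x)) \<and>
     (\<forall>p \<in> A. \<forall>y. 0 < y \<and> y < snd p \<longrightarrow> (\<exists>q \<in> A. snd q = y))"

text \<open>\<open>is_parent A q p\<close>: the point \<open>q\<close> is the parent of the non-root point \<open>p\<close>, that is,
  \<open>q\<close> is the nearest point preceding \<open>p\<close> in its row or in its column.\<close>

definition is_parent :: "(nat \<times> nat) set \<Rightarrow> nat \<times> nat \<Rightarrow> nat \<times> nat \<Rightarrow> bool" where
  "is_parent A q p \<longleftrightarrow> p \<noteq> (1, 1) \<and>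
     (q \<in> row_before A p \<and> (\<forall>r \<in> row_before A p. fst r \<le> fst q) \<or>
      q \<in> col_before A p \<and> (\<forall>r \<in> col_before A p. snd r \<le> snd q))"

definition children :: "(nat \<times> nat) set \<Rightarrow> nat \<times> nat \<Rightarrow> (nat \<times> nat) set" where
  "children A q = {p \<in> A. is_parent A q p}"

definition internal_vertices :: "(nat \<times> nat) set \<Rightarrow> (nat \<times> nat) set" where
  "internal_vertices A = {q \<in> A. children A q \<noteq> {}}"

definition complete_nonambiguous_tree :: "(nat \<times> nat) set \<Rightarrow> bool" where
  "complete_nonambiguous_tree A \<longleftrightarrow> nonambiguous_tree A \<and>
     (\<forall>q \<in> A. card (children A q) = 0 \<or> card (children A q) = 2)"

end

theory Submission
  imports Defs
begin

text \<open>Fix the tiering \<open>t\<close> and delete the smallest vertex \<open>v\<close> of a tree on \<open>V\<close>. Consider two rules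
  prescribing, recursively, the neighbour of \<open>v\<close> in every component \<open>B\<close>: the smallest \<open>u \<in> B\<close> with
  \<open>t u > t v\<close>, or the \<open>u \<in> B\<close> with \<open>t u\<close> largest, provided that \<open>t u > t v\<close>. In both cases the trees
  on \<open>V\<close> correspond to the partitions of \<open>V - {v}\<close> into blocks containing some \<open>u\<close> with \<open>t u > t v\<close>,
  together with a tree of the same kind on each block. Hence both rules yield the same number of
  trees. The first rule describes the trees of weight \<open>0\<close>.

  The second rule describes complete nonambiguous trees. In such a set \<open>A\<close> every row and every
  column ends in a leaf, and each contains exactly one, so the leaves form the graph
  \<open>v \<mapsto> n + 1 - t v\<close> for a permutation \<open>t\<close> of \<open>{1..n}\<close>. An internal point is read as an edge joining
  the leaf of its column to the leaf of its row. This gives a fully tiered tree, and the condition that no point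
  has both a point to its left and a point above it is equivalent to the second rule.\<close>

section \<open>Trees and the components left by deleting a vertex\<close>

text \<open>The two rules can be compared because the prescribed neighbour depends only on
  \<open>t\<close>, the deleted vertex and the block, never on the tree inside the block. The
  resulting recursion for the number of trees no longer mentions the rule. So the bijection between
  the two families is obtained from equal finite cardinalities, for each fixed \<open>t\<close>, and
  is not explicit; only the passage from trees to point sets is. The recursion leaves
  \<open>{1..n}\<close> at once, hence the general finite vertex sets.

  The obstacle lies on the side of the point sets, where every point except the root must have a
  predecessor in exactly one of two directions. For trees, "not both" already implies "at least
  one", so only the former enters the definition of \<open>unambiguous_trees\<close>, and the latter
  is proved by induction. For a graph read off a point set the tree property itself has to be
  proved: "not both" excludes cycles, and "at least one" makes the graph connected.\<close>

lemma adj_on_mono: "V \<subseteq> V' \<Longrightarrow> E \<subseteq> E' \<Longrightarrow> adj_on V E \<subseteq> adj_on V' E'"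
  by (auto simp: adj_on_def)

lemma sym_adj_on: "sym (adj_on V E)"
  by (auto simp: adj_on_def sym_def insert_commute)

lemma adj_on_rtrancl_sym: "(x, y) \<in> (adj_on V E)\<^sup>* \<Longrightarrow> (y, x) \<in> (adj_on V E)\<^sup>*"
  by (meson sym_adj_on sym_rtrancl symE)

text \<open>Prepending a step may revisit a vertex of the path; cutting the path back to that vertex
  keeps its entries distinct.\<close>

lemma rtrancl_distinct_path:
  assumes "(a, b) \<in> R\<^sup>*"
  shows "\<exists>xs. xs \<noteq> [] \<and> distinct xs \<and> hd xs = a \<and> last xs = b \<and> successively (\<lambda>x y. (x, y) \<in> R) xs"
  using assms
proof (induction rule: converse_rtrancl_induct)
  case base
  show ?case by (rule exI[of _ "[b]"]) auto
next
  case (step y z)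
  then obtain xs where xs: "xs \<noteq> []" "distinct xs" "hd xs = z" "last xs = b"
    "successively (\<lambda>x y. (x, y) \<in> R) xs" by blast
  show ?case
  proof (cases "y \<in> set xs")
    case True
    then obtain us ws where "xs = us @ y # ws" by (meson split_list)
    with xs show ?thesis
      by (intro exI[of _ "y # ws"]) (auto simp: successively_append_iff split: if_splits)
  next
    case False
    with xs step(1) show ?thesis
      by (intro exI[of _ "y # xs"]) (auto simp: successively_Cons)
  qed
qed

text \<open>A simple path from \<open>a\<close> to \<open>b\<close> avoiding the edge
  \<open>{a, b}\<close> is closed to a cycle by this edge. It has at least three vertices: one would
  mean \<open>a = b\<close>, and two would mean that the path is the deleted edge.\<close>

lemma cycle_if_not_bridge:
  assumes "{a, b} \<in> E" "a \<noteq> b" "(a, b) \<in> (adj_on V (E - {{a, b}}))\<^sup>*"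
  shows "\<exists>vs. is_cycle E vs"
proof -
  obtain xs where xs: "xs \<noteq> []" "distinct xs" "hd xs = a" "last xs = b"
    "successively (\<lambda>x y. (x, y) \<in> adj_on V (E - {{a, b}})) xs"
    using rtrancl_distinct_path[OF assms(3)] by blast
  have step: "{xs ! i, xs ! Suc i} \<in> E - {{a, b}}" if "Suc i < length xs" for i
    using xs(5) that by (auto simp: successively_conv_nth adj_on_def)
  have h0: "xs ! 0 = a" and hl: "xs ! (length xs - 1) = b"
    using xs by (simp_all add: hd_conv_nth last_conv_nth)
  have "length xs \<noteq> 1" using h0 hl \<open>a \<noteq> b\<close> by auto
  moreover have "length xs \<noteq> 2"
    using step[of 0] h0 hl by auto
  moreover have "length xs \<noteq> 0" using xs by simp
  ultimately have len: "length xs \<ge> 3" by linarith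
  have "{xs ! i, xs ! (Suc i mod length xs)} \<in> E" if "i < length xs" for i
  proof (cases "Suc i < length xs")
    case True
    with step show ?thesis by auto
  next
    case False
    with that have "Suc i = length xs" by simp
    then show ?thesis using h0 hl assms(1)
      by (metis diff_Suc_1 insert_commute mod_self)
  qed
  with len xs(2) show ?thesis unfolding is_cycle_def by blast
qed

text \<open>The witness is the edge between the last and the first entry of the cycle. The remaining
  edges join its ends, and none of them equals it because the entries are distinct and there are at
  least three.\<close>

lemma not_bridge_if_cycle:
  assumes "is_cycle E vs" "\<And>e. e \<in> E \<Longrightarrow> e \<subseteq> V"
  shows "\<exists>a b. {a, b} \<in> E \<and> (a, b) \<in> (adj_on V (E - {{a, b}}))\<^sup>*"
proof -
  let ?l = "length vs - 1"
  have vs: "length vs \<ge> 3" "distinct vs"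
    and ed: "\<And>i. i < length vs \<Longrightarrow> {vs ! i, vs ! (Suc i mod length vs)} \<in> E"
    using assms(1) unfolding is_cycle_def by auto
  have l: "?l < length vs" "Suc ?l = length vs" using vs(1) by linarith+
  then have last: "{vs ! 0, vs ! ?l} \<in> E"
    using ed[OF l(1)] by (simp add: insert_commute)
  have "i < length vs \<Longrightarrow> (vs ! 0, vs ! i) \<in> (adj_on V (E - {{vs ! 0, vs ! ?l}}))\<^sup>*" for i
  proof (induction i)
    case 0
    show ?case by simp
  next
    case (Suc i)
    have e: "{vs ! i, vs ! Suc i} \<in> E" using ed[of i] Suc.prems by simp
    have "{vs ! i, vs ! Suc i} \<noteq> {vs ! 0, vs ! ?l}"
    proof
      assume "{vs ! i, vs ! Suc i} = {vs ! 0, vs ! ?l}"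
      then have "vs ! i = vs ! 0 \<and> vs ! Suc i = vs ! ?l \<or> vs ! i = vs ! ?l \<and> vs ! Suc i = vs ! 0"
        by (auto simp: doubleton_eq_iff)
      then show False
      proof
        assume a: "vs ! i = vs ! 0 \<and> vs ! Suc i = vs ! ?l"
        have "vs \<noteq> []" using vs by auto
        then have "i = 0" "Suc i = ?l"
          using a Suc.prems nth_eq_iff_index_eq[OF vs(2), of i 0]
            nth_eq_iff_index_eq[OF vs(2), of "Suc i" ?l] by auto
        then show False using vs by simp
      next
        assume a: "vs ! i = vs ! ?l \<and> vs ! Suc i = vs ! 0"
        then show False
          using Suc.prems nth_eq_iff_index_eq[OF vs(2), of "Suc i" 0] by (metis nat.distinct(1) length_pos_if_in_set nth_mem)
      qed
    qed
    with e assms(2)[OF e] have "(vs ! i, vs ! Suc i) \<in> adj_on V (E - {{vs ! 0, vs ! ?l}})"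
      by (auto simp: adj_on_def)
    with Suc.IH Suc.prems show ?case by (blast dest: Suc_lessD intro: rtrancl_into_rtrancl)
  qed
  from this[OF l(1)] last show ?thesis by blast
qed

text \<open>In the form "every edge is a bridge", acyclicity can be checked by mapping walks to
  walks, which suits the gluing of trees better than lists forming cycles.\<close>

lemma is_tree_iff_bridges:
  "is_tree V E \<longleftrightarrow> finite V \<and> V \<noteq> {} \<and> (\<forall>e \<in> E. e \<subseteq> V \<and> card e = 2) \<and>
     (\<forall>u \<in> V. \<forall>v \<in> V. (u, v) \<in> (adj_on V E)\<^sup>*) \<and>
     (\<forall>a b. {a, b} \<in> E \<longrightarrow> (a, b) \<notin> (adj_on V (E - {{a, b}}))\<^sup>*)"
proof -
  have "(\<nexists>vs. is_cycle E vs) \<longleftrightarrow> (\<forall>a b. {a, b} \<in> E \<longrightarrow> (a, b) \<notin> (adj_on V (E - {{a, b}}))\<^sup>*)"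
    if "\<forall>e \<in> E. e \<subseteq> V \<and> card e = 2"
  proof -
    have "a \<noteq> b" if "{a, b} \<in> E" for a b
      using that \<open>\<forall>e \<in> E. e \<subseteq> V \<and> card e = 2\<close> by fastforce
    then show ?thesis
      using cycle_if_not_bridge not_bridge_if_cycle that by metis
  qed
  then show ?thesis unfolding is_tree_def by meson
qed

lemma component_eq:
  assumes "B \<in> components U E" "x \<in> B"
  shows "B = (adj_on U E)\<^sup>* `` {x}"
proof -
  obtain z where z: "B = (adj_on U E)\<^sup>* `` {z}"
    using assms(1) by (auto simp: components_def quotient_def)
  with assms(2) have "(z, x) \<in> (adj_on U E)\<^sup>*" by auto
  with z show ?thesis
    by (auto intro: rtrancl_trans dest: adj_on_rtrancl_sym)
qed

lemma partition_on_components: "partition_on U (components U E)"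
proof (rule partition_onI)
  show "{} \<notin> components U E"
    by (auto simp: components_def quotient_def)
  show "\<Union> (components U E) = U"
  proof
    show "\<Union> (components U E) \<subseteq> U" using components_subset by blast
    show "U \<subseteq> \<Union> (components U E)"
    proof
      fix x assume "x \<in> U"
      then have "(adj_on U E)\<^sup>* `` {x} \<in> components U E"
        by (auto simp: components_def quotient_def)
      then show "x \<in> \<Union> (components U E)" by blast
    qed
  qed
  show "disjnt p p'" if "p \<in> components U E" "p' \<in> components U E" "p \<noteq> p'" for p p'
    unfolding disjnt_iff using component_eq[OF that(1)] component_eq[OF that(2)] that(3) by metis
qed

text \<open>A walk that starts in \<open>B\<close> never leaves \<open>B\<close>, so all its edges
  already lie inside \<open>B\<close>.\<close>

lemma component_connected:
  assumes "B \<in> components U E" "x \<in> B" "y \<in> B"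
  shows "(x, y) \<in> (adj_on B (E \<inter> Pow B))\<^sup>*"
proof -
  have B: "B = (adj_on U E)\<^sup>* `` {x}" by (rule component_eq[OF assms(1,2)])
  have "(x, y) \<in> (adj_on U E)\<^sup>*" using B assms(3) by auto
  then show ?thesis
  proof (induction rule: rtrancl_induct)
    case base
    show ?case by simp
  next
    case (step y z)
    have "y \<in> B" "z \<in> B" using B step(1,2) by (auto intro: rtrancl_into_rtrancl)
    with step(2) have "(y, z) \<in> adj_on B (E \<inter> Pow B)" by (auto simp: adj_on_def)
    with step(3) show ?case by (rule rtrancl_into_rtrancl)
  qed
qed

text \<open>The walk is cut at its first arrival at \<open>v\<close>; \<open>u\<close> is the vertex
  just before.\<close>

lemma last_step_before:
  assumes "(b, v) \<in> (adj_on V E)\<^sup>*" "b \<noteq> v"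
  shows "\<exists>u. (b, u) \<in> (adj_on (V - {v}) E)\<^sup>* \<and> u \<in> V - {v} \<and> {v, u} \<in> E"
  using assms
proof (induction rule: converse_rtrancl_induct)
  case base
  then show ?case by simp
next
  case (step y z)
  show ?case
  proof (cases "z = v")
    case True
    with step show ?thesis by (auto simp: adj_on_def insert_commute)
  next
    case False
    with step obtain u where u: "(z, u) \<in> (adj_on (V - {v}) E)\<^sup>*" "u \<in> V - {v}" "{v, u} \<in> E"
      by blast
    have "(y, z) \<in> adj_on (V - {v}) E" using step False by (auto simp: adj_on_def)
    with u show ?thesis by (meson converse_rtrancl_into_rtrancl)
  qed
qed

text \<open>A walk from the component to \<open>v\<close> yields a neighbour. With two neighbours
  \<open>u'\<close> and \<open>u''\<close>, the edge \<open>{v, u'}\<close> would be bypassed by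
  going from \<open>v\<close> to \<open>u''\<close> and then inside \<open>B\<close> to
  \<open>u'\<close>, so it would not be a bridge. This also justifies the definite description in
  \<open>weight\<close>.\<close>

lemma tree_component_neighbour:
  assumes T: "is_tree V E" and "v \<in> V" and B: "B \<in> components (V - {v}) E"
  shows "\<exists>!u. u \<in> B \<and> {v, u} \<in> E"
proof -
  have BV: "B \<subseteq> V - {v}" using components_subset[OF B] .
  have "B \<noteq> {}" using B partition_on_components by (metis partition_onD3)
  then obtain b where b: "b \<in> B" by blast
  then have "(b, v) \<in> (adj_on V E)\<^sup>*" using T BV \<open>v \<in> V\<close> unfolding is_tree_def by blast
  moreover have "b \<noteq> v" using b BV by blast
  ultimately obtain u where u: "(b, u) \<in> (adj_on (V - {v}) E)\<^sup>*" "{v, u} \<in> E"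
    using last_step_before by metis
  have "u \<in> B" using component_eq[OF B b] u by auto
  moreover have "u' = u''" if "u' \<in> B" "u'' \<in> B" "{v, u'} \<in> E" "{v, u''} \<in> E" for u' u''
  proof (rule ccontr)
    assume ne: "u' \<noteq> u''"
    have "(u'', u') \<in> (adj_on B (E \<inter> Pow B))\<^sup>*" by (rule component_connected[OF B]) fact+
    moreover have "adj_on B (E \<inter> Pow B) \<subseteq> adj_on V (E - {{v, u'}})"
      using BV by (auto simp: adj_on_def)
    ultimately have "(u'', u') \<in> (adj_on V (E - {{v, u'}}))\<^sup>*" using rtrancl_mono by blast
    moreover have "(v, u'') \<in> adj_on V (E - {{v, u'}})"
      using that BV \<open>v \<in> V\<close> ne by (auto simp: adj_on_def doubleton_eq_iff)
    ultimately have "(v, u') \<in> (adj_on V (E - {{v, u'}}))\<^sup>*"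
      by (meson converse_rtrancl_into_rtrancl)
    with T that show False unfolding is_tree_iff_bridges by blast
  qed
  ultimately show ?thesis using u by blast
qed

lemma tree_component_tree:
  assumes T: "is_tree V E" and B: "B \<in> components (V - {v}) E"
  shows "is_tree B (E \<inter> Pow B)"
  unfolding is_tree_def
proof (intro conjI ballI)
  have BV: "B \<subseteq> V - {v}" using components_subset[OF B] .
  show "finite B" using T BV finite_subset unfolding is_tree_def by blast
  show "B \<noteq> {}" using B partition_on_components by (metis partition_onD3)
  show "e \<subseteq> B" "card e = 2" if "e \<in> E \<inter> Pow B" for e
    using that T unfolding is_tree_def by auto
  show "(x, y) \<in> (adj_on B (E \<inter> Pow B))\<^sup>*" if "x \<in> B" "y \<in> B" for x y
    by (rule component_connected[OF B that])
  show "\<nexists>vs. is_cycle (E \<inter> Pow B) vs"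
    using T unfolding is_tree_def is_cycle_def by blast
qed

lemma tree_edge_cases:
  assumes T: "is_tree V E" and e: "e \<in> E"
  obtains B where "B \<in> components (V - {v}) E" "e \<subseteq> B"
  | B u where "B \<in> components (V - {v}) E" "u \<in> B" "e = {v, u}"
proof -
  have part: "\<Union> (components (V - {v}) E) = V - {v}"
    using partition_on_components by (metis partition_onD1)
  obtain x y where xy: "e = {x, y}" "x \<noteq> y"
    using T e unfolding is_tree_def by (meson card_2_iff)
  have V: "x \<in> V" "y \<in> V" using T e xy unfolding is_tree_def by auto
  consider "x = v" | "y = v" | "x \<noteq> v" "y \<noteq> v" by blast
  then show thesis
  proof cases
    case 1
    then show thesis using that(2) V xy part by blast
  next
    case 2
    then show thesis using that(2)[of _ x] V xy part by blast
  next
    case 3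
    then obtain B where B: "B \<in> components (V - {v}) E" "x \<in> B" using V part by blast
    have "(x, y) \<in> adj_on (V - {v}) E" using 3 V e xy by (auto simp: adj_on_def)
    then have "y \<in> B" using component_eq[OF B] by auto
    then show thesis using that(1) B xy by blast
  qed
qed

text \<open>Every edge of \<open>E\<close> lies inside a block or contains \<open>v\<close>, so a
  walk avoiding \<open>v\<close> cannot leave its block; this determines the components. For the
  bridge property there are two kinds of edges: without \<open>{v, c B}\<close> no edge leads out of
  \<open>B\<close>, and a detour around an edge inside \<open>B\<close> could be pushed into
  \<open>B\<close>, contradicting that \<open>h B\<close> is a tree.\<close>

lemma tree_glue:
  fixes h :: "'a set \<Rightarrow> 'a set set"
  assumes fin: "finite V" and v: "v \<in> V" and P: "partition_on (V - {v}) P"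
    and tree: "\<And>B. B \<in> P \<Longrightarrow> is_tree B (h B)" and c: "\<And>B. B \<in> P \<Longrightarrow> c B \<in> B"
  defines "E \<equiv> \<Union> (h ` P) \<union> (\<lambda>B. {v, c B}) ` P"
  shows "is_tree V E" "components (V - {v}) E = P" "\<And>B. B \<in> P \<Longrightarrow> E \<inter> Pow B = h B"
proof -
  have sub: "B \<subseteq> V - {v}" if "B \<in> P" for B using P that by (metis partition_onD1 Union_upper)
  have disj: "B = B'" if "B \<in> P" "B' \<in> P" "x \<in> B" "x \<in> B'" for B B' x
    using P that unfolding partition_on_def disjoint_def by blast
  have cover: "\<exists>B\<in>P. x \<in> B" if "x \<in> V - {v}" for x
    using P that by (metis partition_onD1 UnionE)
  have hsub: "e \<subseteq> B" "card e = 2" if "B \<in> P" "e \<in> h B" for B e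
    using tree[OF that(1)] that(2) unfolding is_tree_def by auto
  have hE: "h B \<subseteq> E" if "B \<in> P" for B using that unfolding E_def by blast
  have cE: "{v, c B} \<in> E" if "B \<in> P" for B using that unfolding E_def by blast
  have Ecases: "(\<exists>B\<in>P. e \<in> h B) \<or> (\<exists>B\<in>P. e = {v, c B})" if "e \<in> E" for e
    using that unfolding E_def by blast
  show restr: "E \<inter> Pow B = h B" if B: "B \<in> P" for B
  proof
    show "h B \<subseteq> E \<inter> Pow B" using hE[OF B] hsub[OF B] by blast
    show "E \<inter> Pow B \<subseteq> h B"
    proof
      fix e assume e: "e \<in> E \<inter> Pow B"
      have "v \<notin> e" using e sub[OF B] by blast
      then obtain B' where B': "B' \<in> P" "e \<in> h B'" using Ecases e by blast
      have "e \<noteq> {}" using hsub[OF B'] by auto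
      then have "B' = B" using disj[OF B'(1) B] hsub[OF B'] e by blast
      with B' show "e \<in> h B" by simp
    qed
  qed
  have conB: "(x, y) \<in> (adj_on B (h B))\<^sup>*" if "B \<in> P" "x \<in> B" "y \<in> B" for B x y
    using tree[OF that(1)] that unfolding is_tree_def by blast
  have closed: "y \<in> B" if "B \<in> P" "x \<in> B" "(x, y) \<in> (adj_on (V - {v}) E)\<^sup>*" for B x y
    using that(3,2)
  proof (induction rule: rtrancl_induct)
    case (step y z)
    then have e: "{y, z} \<in> E" "y \<in> B" "y \<noteq> v" "z \<noteq> v" by (auto simp: adj_on_def)
    then obtain B' where B': "B' \<in> P" "{y, z} \<in> h B'" using Ecases[OF e(1)]
      by (metis doubleton_eq_iff)
    then show ?case using hsub(1)[OF B'] disj[OF that(1) B'(1) e(2)] by blast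
  qed
  have class_eq: "(adj_on (V - {v}) E)\<^sup>* `` {x} = B" if "B \<in> P" "x \<in> B" for x B
  proof
    show "(adj_on (V - {v}) E)\<^sup>* `` {x} \<subseteq> B" using closed[OF that] by auto
    have "adj_on B (h B) \<subseteq> adj_on (V - {v}) E"
      by (rule adj_on_mono) (use sub hE that in auto)
    then show "B \<subseteq> (adj_on (V - {v}) E)\<^sup>* `` {x}"
      using conB[OF that] rtrancl_mono by blast
  qed
  show "components (V - {v}) E = P"
  proof
    show "components (V - {v}) E \<subseteq> P"
      unfolding components_def quotient_def using cover class_eq by fastforce
    show "P \<subseteq> components (V - {v}) E"
    proof
      fix B assume B: "B \<in> P"
      then show "B \<in> components (V - {v}) E"
        unfolding components_def quotient_def using class_eq[OF B c[OF B]] c[OF B] sub[OF B] by blast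
    qed
  qed
  show "is_tree V E"
    unfolding is_tree_iff_bridges
  proof (intro conjI ballI allI impI)
    show "finite V" "V \<noteq> {}" using fin v by auto
    show "e \<subseteq> V" if e: "e \<in> E" for e
      using Ecases[OF e] hsub sub c v by blast
    show "card e = 2" if e: "e \<in> E" for e
    proof -
      have "v \<noteq> c B" if "B \<in> P" for B using sub[OF that] c[OF that] by blast
      with Ecases[OF e] hsub show ?thesis by (auto simp: card_2_iff)
    qed
    have tov: "(x, v) \<in> (adj_on V E)\<^sup>*" if xV: "x \<in> V" for x
    proof (cases "x = v")
      case False
      then obtain B where B: "B \<in> P" "x \<in> B" using cover[of x] xV by blast
      have "adj_on B (h B) \<subseteq> adj_on V E"
        by (rule adj_on_mono) (use sub hE B in auto)
      then have "(x, c B) \<in> (adj_on V E)\<^sup>*"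
        using conB[OF B c[OF B(1)]] rtrancl_mono by blast
      moreover have "(c B, v) \<in> adj_on V E"
        using cE[OF B(1)] v sub[OF B(1)] c[OF B(1)] by (auto simp: adj_on_def insert_commute)
      ultimately show ?thesis by (rule rtrancl_into_rtrancl)
    qed simp
    show "(x, y) \<in> (adj_on V E)\<^sup>*" if "x \<in> V" "y \<in> V" for x y
      using tov[OF that(1)] adj_on_rtrancl_sym[OF tov[OF that(2)]] by (rule rtrancl_trans)
    \<comment> \<open>\<open>{v, c B}\<close> is the only edge of \<open>E\<close> with exactly one
      end in \<open>B\<close>; after its deletion a walk from \<open>c B\<close> is trapped.\<close>
    have stay: "y \<in> B" if "B \<in> P" "(c B, y) \<in> (adj_on V (E - {{v, c B}}))\<^sup>*" for B y
      using that(2)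
    proof (induction rule: rtrancl_induct)
      case base
      show ?case by (rule c[OF that(1)])
    next
      case (step y z)
      have yz: "{y, z} \<in> E" "{y, z} \<noteq> {v, c B}" using step(2) by (auto simp: adj_on_def)
      have "\<not> (\<exists>B'\<in>P. {y, z} = {v, c B'})"
      proof
        assume "\<exists>B'\<in>P. {y, z} = {v, c B'}"
        then obtain B' where B': "B' \<in> P" "{y, z} = {v, c B'}" by blast
        have "y \<noteq> v" using step(3) sub[OF that(1)] by blast
        then have "y = c B'" using B' by (auto simp: doubleton_eq_iff)
        then have "B = B'" using disj[OF that(1) B'(1) step(3)] c[OF B'(1)] by simp
        with B' yz show False by simp
      qed
      then obtain B' where B': "B' \<in> P" "{y, z} \<in> h B'" using Ecases[OF yz(1)] by blast
      then show ?case using hsub(1)[OF B'] disj[OF that(1) B'(1) step(3)] by blast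
    qed
    show "(a, b) \<notin> (adj_on V (E - {{a, b}}))\<^sup>*" if ab: "{a, b} \<in> E" for a b
    proof
      assume path: "(a, b) \<in> (adj_on V (E - {{a, b}}))\<^sup>*"
      show False
      proof (cases "\<exists>B\<in>P. {a, b} = {v, c B}")
        case True
        then obtain B where B: "B \<in> P" "{a, b} = {v, c B}" by blast
        have "(c B, v) \<in> (adj_on V (E - {{v, c B}}))\<^sup>*"
        proof -
          have "a = v \<and> b = c B \<or> a = c B \<and> b = v" using B(2) by (simp add: doubleton_eq_iff)
          then show ?thesis using path[unfolded B(2)] by (auto intro: adj_on_rtrancl_sym)
        qed
        then have "v \<in> B" by (rule stay[OF B(1)])
        with sub[OF B(1)] show False by blast
      next
        case False
        then obtain B where B: "B \<in> P" "{a, b} \<in> h B" using Ecases[OF ab] by blast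
        \<comment> \<open>Collapsing everything outside \<open>B\<close> to \<open>c B\<close> turns the path into one inside \<open>B\<close>.\<close>
        define r where "r x = (if x \<in> B then x else c B)" for x
        have rstep: "(r x, r y) \<in> (adj_on B (h B - {{a, b}}))\<^sup>*"
          if "(x, y) \<in> adj_on V (E - {{a, b}})" for x y
        proof -
          have xy: "{x, y} \<in> E" "{x, y} \<noteq> {a, b}" using that by (auto simp: adj_on_def)
          from Ecases[OF xy(1)] show ?thesis
          proof
            assume "\<exists>B'\<in>P. {x, y} \<in> h B'"
            then obtain B' where B': "B' \<in> P" "{x, y} \<in> h B'" by blast
            show ?thesis
            proof (cases "B' = B")
              case True
              then have "r x = x" "r y = y" "x \<in> B" "y \<in> B"
                using hsub(1)[OF B'] by (auto simp: r_def)
              then have "(r x, r y) \<in> adj_on B (h B - {{a, b}})"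
                using B' True xy by (auto simp: adj_on_def)
              then show ?thesis by blast
            next
              case False
              then have "x \<notin> B" "y \<notin> B" using hsub(1)[OF B'] disj[OF B(1) B'(1)] by blast+
              then show ?thesis by (simp add: r_def)
            qed
          next
            assume "\<exists>B'\<in>P. {x, y} = {v, c B'}"
            then obtain B' where B': "B' \<in> P" "{x, y} = {v, c B'}" by blast
            have "r v = c B" using sub[OF B(1)] by (auto simp: r_def)
            moreover have "r (c B') = c B"
              using disj[OF B(1) B'(1) _ c[OF B'(1)]] by (auto simp: r_def)
            ultimately have "r x = c B" "r y = c B" using B'(2) by (auto simp: doubleton_eq_iff)
            then show ?thesis by simp
          qed
        qed
        have "(r a, r z) \<in> (adj_on B (h B - {{a, b}}))\<^sup>*"
          if "(a, z) \<in> (adj_on V (E - {{a, b}}))\<^sup>*" for z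
          using that
        proof (induction rule: rtrancl_induct)
          case (step y z)
          from step(3) rstep[OF step(2)] show ?case by (rule rtrancl_trans)
        qed simp
        from this[OF path] have "(r a, r b) \<in> (adj_on B (h B - {{a, b}}))\<^sup>*" .
        moreover have "r a = a" "r b = b" using hsub(1)[OF B] by (auto simp: r_def)
        ultimately show False using tree[OF B(1)] B(2) unfolding is_tree_iff_bridges by auto
      qed
    qed
  qed
qed

section \<open>Trees with a prescribed neighbour of the minimum\<close>

lemma tree_edges_eq:
  assumes T: "is_tree V E" and v: "v \<in> V"
    and c: "\<And>B. B \<in> components (V - {v}) E \<Longrightarrow> c B \<in> B \<and> {v, c B} \<in> E"
  shows "E = \<Union> ((\<lambda>B. E \<inter> Pow B) ` components (V - {v}) E) \<union> (\<lambda>B. {v, c B}) ` components (V - {v}) E"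
    (is "E = ?R")
proof
  show "E \<subseteq> ?R"
  proof
    fix e assume e: "e \<in> E"
    from T e show "e \<in> ?R"
    proof (cases rule: tree_edge_cases[where v = v])
      case (1 B)
      with e show ?thesis by blast
    next
      case (2 B u)
      then have "u = c B" using tree_component_neighbour[OF T v 2(1)] c[OF 2(1)] e by blast
      with 2 show ?thesis by blast
    qed
  qed
  show "?R \<subseteq> E" using c by blast
qed

lemma finite_components: "finite V \<Longrightarrow> finite (components V E)"
  by (rule finite_elements[OF _ partition_on_components])

text \<open>Deleting \<open>v\<close> removes exactly one edge per component, and this edge is the
  excess vertex of that component in the induction hypothesis. The count is needed because internal
  points will correspond to edges.\<close>

lemma card_tree:
  assumes "is_tree V E"
  shows "card V = Suc (card E)"
  using assms
proof (induction "card V" arbitrary: V E rule: less_induct)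
  case less
  note T = less.prems
  obtain v where v: "v \<in> V" using T unfolding is_tree_def by blast
  have fin: "finite V" using T unfolding is_tree_def by blast
  let ?P = "components (V - {v}) E"
  have part: "partition_on (V - {v}) ?P" by (rule partition_on_components)
  have finP: "finite ?P" using fin by (simp add: finite_components)
  have sub: "B \<subseteq> V - {v}" if "B \<in> ?P" for B using components_subset[OF that] .
  have "\<forall>B \<in> ?P. \<exists>u. u \<in> B \<and> {v, u} \<in> E" using tree_component_neighbour[OF T v] by blast
  then obtain c where c: "\<And>B. B \<in> ?P \<Longrightarrow> c B \<in> B \<and> {v, c B} \<in> E" by metis
  have disj: "B = B'" if "B \<in> ?P" "B' \<in> ?P" "x \<in> B" "x \<in> B'" for B B' x
    using part that unfolding partition_on_def disjoint_def by blast
  have cardB: "card B = Suc (card (E \<inter> Pow B))" if "B \<in> ?P" for B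
  proof (rule less.hyps)
    show "card B < card V" using sub[OF that] fin v by (intro psubset_card_mono) auto
    show "is_tree B (E \<inter> Pow B)" by (rule tree_component_tree[OF T that])
  qed
  have finE: "finite E"
    using T fin unfolding is_tree_def by (meson Pow_iff finite_Pow_iff finite_subset subsetI)
  have ne: "e \<noteq> {}" if "e \<in> E" for e using T that unfolding is_tree_def by force
  have "card E = card (\<Union> ((\<lambda>B. E \<inter> Pow B) ` ?P) \<union> (\<lambda>B. {v, c B}) ` ?P)"
    using tree_edges_eq[OF T v c] by simp
  also have "\<dots> = card (\<Union> ((\<lambda>B. E \<inter> Pow B) ` ?P)) + card ((\<lambda>B. {v, c B}) ` ?P)"
  proof (rule card_Un_disjoint)
    show "finite (\<Union> ((\<lambda>B. E \<inter> Pow B) ` ?P))" using finE by (rule finite_subset[rotated]) blast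
    show "finite ((\<lambda>B. {v, c B}) ` ?P)" using finP by simp
    show "\<Union> ((\<lambda>B. E \<inter> Pow B) ` ?P) \<inter> (\<lambda>B. {v, c B}) ` ?P = {}" using sub by blast
  qed
  also have "card (\<Union> ((\<lambda>B. E \<inter> Pow B) ` ?P)) = (\<Sum>B\<in>?P. card (E \<inter> Pow B))"
  proof (rule card_UN_disjoint)
    show "\<forall>B\<in>?P. \<forall>B'\<in>?P. B \<noteq> B' \<longrightarrow> E \<inter> Pow B \<inter> (E \<inter> Pow B') = {}"
    proof (intro ballI impI)
      fix B B' assume B: "B \<in> ?P" "B' \<in> ?P" "B \<noteq> B'"
      have "B \<inter> B' = {}" using disj B by blast
      then show "E \<inter> Pow B \<inter> (E \<inter> Pow B') = {}" using ne by blast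
    qed
  qed (use finP finE in auto)
  also have "card ((\<lambda>B. {v, c B}) ` ?P) = card ?P"
  proof (rule card_image, rule inj_onI)
    fix B B' assume B: "B \<in> ?P" "B' \<in> ?P" "{v, c B} = {v, c B'}"
    then have "c B = c B'" by (metis doubleton_eq_iff)
    then show "B = B'" using disj[OF B(1,2)] c B by metis
  qed
  also have "(\<Sum>B\<in>?P. card (E \<inter> Pow B)) + card ?P = (\<Sum>B\<in>?P. card (E \<inter> Pow B) + 1)"
    by (simp only: sum.distrib sum_constant mult_1_right)  simp
  also have "\<dots> = (\<Sum>B\<in>?P. card B)" using cardB by simp
  also have "\<dots> = card (\<Union> ?P)"
    using part fin by (intro card_Union_disjoint[symmetric])
      (auto simp: partition_on_def pairwise_def disjnt_def disjoint_def intro: finite_subset[OF _ fin])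
  also have "\<Union> ?P = V - {v}" using part by (metis partition_onD1)
  finally show ?case using v fin by (metis card_Suc_Diff1)
qed

definition blockings :: "(nat \<Rightarrow> nat) \<Rightarrow> nat set \<Rightarrow> nat set set set" where
  "blockings t V = {P. partition_on (V - {Min V}) P \<and> (\<forall>B \<in> P. \<exists>u \<in> B. t (Min V) < t u)}"

text \<open>The recursion determines \<open>G\<close>; \<open>c v B\<close> is the prescribed neighbour of \<open>v\<close> in the component \<open>B\<close>.\<close>

definition recursive_trees ::
    "(nat \<Rightarrow> nat) \<Rightarrow> (nat \<Rightarrow> nat set \<Rightarrow> nat) \<Rightarrow> (nat set \<Rightarrow> nat set set set) \<Rightarrow> bool" where
  "recursive_trees t c G \<longleftrightarrow>
     (\<forall>v B. finite B \<and> (\<exists>u \<in> B. t v < t u) \<longrightarrow> c v B \<in> B) \<and>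
     (\<forall>V E. E \<in> G V \<longleftrightarrow> is_tree V E \<and>
        (\<forall>B \<in> components (V - {Min V}) E.
           (\<exists>u \<in> B. t (Min V) < t u) \<and> {Min V, c (Min V) B} \<in> E \<and> E \<inter> Pow B \<in> G B))"

lemma recursive_trees_choice:
  "recursive_trees t c G \<Longrightarrow> finite B \<Longrightarrow> \<exists>u \<in> B. t v < t u \<Longrightarrow> c v B \<in> B"
  unfolding recursive_trees_def by blast

lemma recursive_trees_iff:
  "recursive_trees t c G \<Longrightarrow> E \<in> G V \<longleftrightarrow> is_tree V E \<and>
     (\<forall>B \<in> components (V - {Min V}) E.
        (\<exists>u \<in> B. t (Min V) < t u) \<and> {Min V, c (Min V) B} \<in> E \<and> E \<inter> Pow B \<in> G B)"
  unfolding recursive_trees_def by (drule conjunct2, drule spec, erule spec)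

lemma finite_recursive_trees:
  assumes "recursive_trees t c G"
  shows "finite (G V)"
proof (cases "finite V")
  case True
  have "E \<in> Pow (Pow V)" if "E \<in> G V" for E
    using recursive_trees_iff[OF assms, of E V] that by (auto simp: is_tree_def)
  then have "G V \<subseteq> Pow (Pow V)" by (rule subsetI)
  with True show ?thesis by (meson finite_Pow_iff finite_subset)
next
  case False
  then have "E \<notin> G V" for E
    using recursive_trees_iff[OF assms, of E V] by (simp add: is_tree_def)
  then have "G V = {}" by blast
  then show ?thesis by simp
qed

text \<open>Cutting at the minimum and gluing back with the prescribed neighbours are inverse to
  each other. A singleton \<open>V\<close> needs no separate treatment: its only blocking is the
  empty partition, which contributes the empty product 1.\<close>

lemma card_recursive_trees:
  assumes G: "recursive_trees t c G" and V: "finite V" "V \<noteq> {}"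
  shows "card (G V) = (\<Sum>P \<in> blockings t V. \<Prod>B \<in> P. card (G B))"
proof -
  define v where "v = Min V"
  have v: "v \<in> V" using V by (simp add: v_def)
  let ?K = "\<lambda>E. components (V - {v}) E"
  have char: "E \<in> G W \<longleftrightarrow> is_tree W E \<and> (\<forall>B \<in> components (W - {Min W}) E.
      (\<exists>u \<in> B. t (Min W) < t u) \<and> {Min W, c (Min W) B} \<in> E \<and> E \<inter> Pow B \<in> G B)" for W E
    by (rule recursive_trees_iff[OF G])
  have c: "c v B \<in> B" if "B \<subseteq> V" "\<exists>u \<in> B. t v < t u" for B
    using recursive_trees_choice[OF G finite_subset[OF that(1) V(1)] that(2)] .
  have Q: "partition_on (V - {v}) P" "\<And>B. B \<in> P \<Longrightarrow> B \<subseteq> V" "\<And>B. B \<in> P \<Longrightarrow> \<exists>u \<in> B. t v < t u"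
    if "P \<in> blockings t V" for P
    using that unfolding blockings_def v_def[symmetric] by (auto dest: partition_onD1)
  let ?g = "\<lambda>(P, h). \<Union> (h ` P) \<union> (\<lambda>B. {v, c v B}) ` P"
  \<comment> \<open>Extensional functions are used so that a family of trees on the blocks is
    represented, and counted, exactly once.\<close>
  let ?S = "SIGMA P:blockings t V. PiE P G"
  have glue: "is_tree V (?g (P, h))" "?K (?g (P, h)) = P" "\<And>B. B \<in> P \<Longrightarrow> ?g (P, h) \<inter> Pow B = h B"
    if "(P, h) \<in> ?S" for P h
  proof -
    have P: "P \<in> blockings t V" "\<And>B. B \<in> P \<Longrightarrow> h B \<in> G B" using that by auto
    have "is_tree B (h B)" if "B \<in> P" for B
      using P(2)[OF that] char[of "h B" B] by simp
    moreover have "c v B \<in> B" if "B \<in> P" for B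
      using c Q(2,3)[OF P(1) that] by simp
    ultimately have * : "is_tree V (?g (P, h))" "?K (?g (P, h)) = P"
      "\<And>B. B \<in> P \<Longrightarrow> ?g (P, h) \<inter> Pow B = h B"
      using tree_glue[OF V(1) v Q(1)[OF P(1)], of h "c v"] by simp_all
    show "is_tree V (?g (P, h))" "?K (?g (P, h)) = P" "\<And>B. B \<in> P \<Longrightarrow> ?g (P, h) \<inter> Pow B = h B"
      using * by auto
  qed
  have "bij_betw (\<lambda>E. (?K E, \<lambda>B \<in> ?K E. E \<inter> Pow B)) (G V) ?S"
  proof (rule bij_betw_byWitness[where f' = ?g])
    show "\<forall>E \<in> G V. ?g (?K E, \<lambda>B \<in> ?K E. E \<inter> Pow B) = E"
    proof
      fix E assume "E \<in> G V"
      then have E: "is_tree V E" "\<And>B. B \<in> ?K E \<Longrightarrow> (\<exists>u \<in> B. t v < t u) \<and> {v, c v B} \<in> E"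
        using char[of E V] unfolding v_def by simp_all
      have "c v B \<in> B \<and> {v, c v B} \<in> E" if "B \<in> ?K E" for B
        using E(2)[OF that] c components_subset[OF that] by blast
      from tree_edges_eq[OF E(1) v this]
      show "?g (?K E, \<lambda>B \<in> ?K E. E \<inter> Pow B) = E" by simp
    qed
    show "\<forall>p \<in> ?S. (?K (?g p), \<lambda>B \<in> ?K (?g p). ?g p \<inter> Pow B) = p"
    proof
      fix p assume p: "p \<in> ?S"
      obtain P h where ph: "p = (P, h)" by (cases p)
      have "h \<in> extensional P" using p ph by (auto simp: PiE_def)
      moreover have "restrict (\<lambda>B. ?g p \<inter> Pow B) P = restrict h P"
        using glue(3)[of P h] p ph by (intro restrict_ext) blast
      ultimately show "(?K (?g p), \<lambda>B \<in> ?K (?g p). ?g p \<inter> Pow B) = p"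
        using glue(2)[of P h] p ph by (simp add: extensional_restrict)
    qed
    show "(\<lambda>E. (?K E, \<lambda>B \<in> ?K E. E \<inter> Pow B)) ` G V \<subseteq> ?S"
    proof
      fix p assume "p \<in> (\<lambda>E. (?K E, \<lambda>B \<in> ?K E. E \<inter> Pow B)) ` G V"
      then obtain E where E: "E \<in> G V" and p: "p = (?K E, \<lambda>B \<in> ?K E. E \<inter> Pow B)" by blast
      have E': "\<And>B. B \<in> ?K E \<Longrightarrow> (\<exists>u \<in> B. t v < t u) \<and> E \<inter> Pow B \<in> G B"
        using E char[of E V] unfolding v_def by simp
      then have "?K E \<in> blockings t V"
        unfolding blockings_def v_def[symmetric] using partition_on_components by blast
      with E' show "p \<in> ?S" unfolding p by auto
    qed
    show "?g ` ?S \<subseteq> G V"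
    proof
      fix E assume "E \<in> ?g ` ?S"
      then obtain P h where ph: "(P, h) \<in> ?S" and E: "E = ?g (P, h)" by auto
      have "(\<exists>u \<in> B. t v < t u) \<and> {v, c v B} \<in> E \<and> E \<inter> Pow B \<in> G B" if "B \<in> P" for B
      proof (intro conjI)
        show "\<exists>u \<in> B. t v < t u" using Q(3) ph that by blast
        show "{v, c v B} \<in> E" unfolding E using that by auto
        show "E \<inter> Pow B \<in> G B" using glue(3)[OF ph that] ph that unfolding E by auto
      qed
      moreover have "is_tree V E" "?K E = P" using glue(1,2)[OF ph] unfolding E .
      ultimately show "E \<in> G V"
        unfolding char[of E V] v_def[symmetric] by simp
    qed
  qed
  then have "card (G V) = card ?S" by (rule bij_betw_same_card)
  also have "\<dots> = (\<Sum>P \<in> blockings t V. card (PiE P G))"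
  proof (rule card_SigmaI)
    have "P \<in> Pow (Pow V)" if "P \<in> blockings t V" for P using Q(2)[OF that] by auto
    then have "blockings t V \<subseteq> Pow (Pow V)" by (rule subsetI)
    then show "finite (blockings t V)" using V by (meson finite_Pow_iff finite_subset)
    show "\<forall>P \<in> blockings t V. finite (PiE P G)"
    proof
      fix P assume "P \<in> blockings t V"
      then have "finite P" using finite_elements[OF _ Q(1)] V by simp
      then show "finite (PiE P G)" by (rule finite_PiE) (rule finite_recursive_trees[OF G])
    qed
  qed
  also have "\<dots> = (\<Sum>P \<in> blockings t V. \<Prod>B \<in> P. card (G B))"
    using finite_elements[OF _ Q(1)] V by (intro sum.cong refl card_PiE) simp
  finally show ?thesis .
qed

text \<open>Neither \<open>c\<close> nor \<open>d\<close> occurs in the recursion for the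
  cardinality, and all blocks are smaller than \<open>V\<close>.\<close>

lemma recursive_trees_same_card:
  assumes G: "recursive_trees t c G" and H: "recursive_trees t d H"
    and V: "finite V" "V \<noteq> {}"
  shows "card (G V) = card (H V)"
  using V
proof (induction "card V" arbitrary: V rule: less_induct)
  case less
  have "card (G B) = card (H B)" if "P \<in> blockings t V" "B \<in> P" for P B
  proof (rule less.hyps)
    have P: "partition_on (V - {Min V}) P" using that(1) unfolding blockings_def by blast
    have B: "B \<subseteq> V - {Min V}" using P that(2) by (auto dest: partition_onD1)
    have "Min V \<in> V" using less.prems by simp
    with B less.prems show "card B < card V" by (intro psubset_card_mono psubsetI) blast+
    show "finite B" using B less.prems finite_subset by blast
    show "B \<noteq> {}" using P that(2) by (metis partition_onD3)
  qed
  then show ?case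
    unfolding card_recursive_trees[OF G less.prems] card_recursive_trees[OF H less.prems]
    by (intro sum.cong prod.cong) auto
qed

section \<open>Trees of weight zero\<close>

definition tiered :: "nat set set \<Rightarrow> (nat \<Rightarrow> nat) \<Rightarrow> bool" where
  "tiered E t \<longleftrightarrow> (\<forall>u v. {u, v} \<in> E \<and> u > v \<longrightarrow> t u > t v)"

lemma tiered_subset: "tiered E t \<Longrightarrow> F \<subseteq> E \<Longrightarrow> tiered F t"
  unfolding tiered_def by blast

lemma component_props:
  assumes "finite V" "V \<noteq> {}" "B \<in> components (V - {Min V}) E"
  shows "B \<subseteq> V" "finite B" "B \<noteq> {}" "card B < card V" "\<And>u. u \<in> B \<Longrightarrow> Min V < u"
proof -
  have B: "B \<subseteq> V - {Min V}" using components_subset[OF assms(3)] .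
  have V: "Min V \<in> V" using assms by simp
  show "B \<subseteq> V" using B by blast
  then show "finite B" using assms(1) finite_subset by blast
  show "B \<noteq> {}" using assms(3) partition_on_components by (metis partition_onD3)
  show "card B < card V" using B V assms(1) by (intro psubset_card_mono psubsetI) blast+
  show "Min V < u" if "u \<in> B" for u
  proof -
    have "u \<in> V" "u \<noteq> Min V" using that B by auto
    then show ?thesis using assms(1) by (simp add: order_neq_le_trans)
  qed
qed

lemma tiered_if_components_tiered:
  assumes T: "is_tree V E"
    and c: "\<And>B. B \<in> components (V - {Min V}) E \<Longrightarrow>
      c B \<in> B \<and> t (Min V) < t (c B) \<and> {Min V, c B} \<in> E \<and> tiered (E \<inter> Pow B) t"
  shows "tiered E t"
  unfolding tiered_def
proof (intro allI impI)
  fix x y assume xy: "{x, y} \<in> E \<and> x > y"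
  have V: "finite V" "V \<noteq> {}" using T unfolding is_tree_def by auto
  from T conjunct1[OF xy] show "t x > t y"
  proof (cases rule: tree_edge_cases[where v = "Min V"])
    case (1 B)
    then have "{x, y} \<in> E \<inter> Pow B" using xy by blast
    then show ?thesis using c[OF 1(1)] xy unfolding tiered_def by blast
  next
    case (2 B u)
    then have "{Min V, u} \<in> E" using xy by simp
    then have u: "u = c B"
      using tree_component_neighbour[OF T Min_in[OF V] 2(1)] c[OF 2(1)] 2(2) by blast
    have "Min V < u" using component_props(5)[OF V 2(1,2)] .
    then have "x = u" "y = Min V" using 2(3) xy by (auto simp: doubleton_eq_iff)
    then show ?thesis using c[OF 2(1)] u by simp
  qed
qed

lemma weight_eq:
  assumes "finite V" "V \<noteq> {}"
  shows "weight E t V = (\<Sum>C \<in> components (V - {Min V}) E.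
    card {u \<in> C. t u > t (Min V) \<and> u < (THE u'. u' \<in> C \<and> {Min V, u'} \<in> E)} + weight E t C)"
proof (cases "card V > 1")
  case True
  with assms show ?thesis by (subst weight.simps) (simp add: Let_def)
next
  case False
  moreover have "card V > 0" using assms by (simp add: card_gt_0_iff)
  ultimately have "card V = 1" by linarith
  then obtain v where "V = {v}" by (rule card_1_singletonE)
  moreover have "components {} E = {}" by (simp add: components_def quotient_def)
  ultimately show ?thesis by (subst weight.simps) simp
qed

text \<open>The recursive calls of \<open>weight\<close> keep the whole edge set \<open>E\<close>,
  whereas the recursion for families of trees speaks about \<open>E \<inter> Pow B\<close>; this
  reconciles the two.\<close>

lemma weight_restrict:
  assumes "V \<subseteq> W"
  shows "weight (E \<inter> Pow W) t V = weight E t V"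
  using assms
proof (induction "card V" arbitrary: V rule: less_induct)
  case less
  show ?case
  proof (cases "finite V \<and> V \<noteq> {}")
    case True
    then have V: "finite V" "V \<noteq> {}" by auto
    have "adj_on (V - {Min V}) (E \<inter> Pow W) = adj_on (V - {Min V}) E"
      using less.prems by (auto simp: adj_on_def)
    then have K: "components (V - {Min V}) (E \<inter> Pow W) = components (V - {Min V}) E"
      by (simp add: components_def)
    show ?thesis
      unfolding weight_eq[OF V] K
    proof (rule sum.cong[OF refl])
      fix C assume C: "C \<in> components (V - {Min V}) E"
      note CV = component_props[OF V C]
      have "weight (E \<inter> Pow W) t C = weight E t C"
        using less.hyps[OF CV(4)] CV(1) less.prems by blast
      moreover have "u' \<in> C \<and> {Min V, u'} \<in> E \<inter> Pow W \<longleftrightarrow> u' \<in> C \<and> {Min V, u'} \<in> E" for u'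
        using CV(1) less.prems Min_in[OF V] by blast
      ultimately show "card {u \<in> C. t u > t (Min V) \<and> u < (THE u'. u' \<in> C \<and> {Min V, u'} \<in> E \<inter> Pow W)}
          + weight (E \<inter> Pow W) t C =
        card {u \<in> C. t u > t (Min V) \<and> u < (THE u'. u' \<in> C \<and> {Min V, u'} \<in> E)} + weight E t C"
        by presburger
    qed
  next
    case False
    then have "\<not> (finite V \<and> card V > 1)" by auto
    then show ?thesis by (simp only: weight.simps[of _ _ V] if_False)
  qed
qed

definition weight_zero_trees :: "(nat \<Rightarrow> nat) \<Rightarrow> nat set \<Rightarrow> nat set set set" where
  "weight_zero_trees t V = {E. is_tree V E \<and> tiered E t \<and> weight E t V = 0}"

text \<open>Let \<open>u\<close> be the neighbour of \<open>v\<close> in a component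
  \<open>B\<close>. Tieredness at the edge \<open>{v, u}\<close> means \<open>t v < t u\<close>, and
  a vanishing contribution of \<open>B\<close> means that no smaller element of \<open>B\<close> has
  a tier above \<open>t v\<close>. Together they say that \<open>u\<close> is the minimum in
  question.\<close>

lemma recursive_weight_zero_trees:
  "recursive_trees t (\<lambda>v B. Min {u \<in> B. t v < t u}) (weight_zero_trees t)"
  unfolding recursive_trees_def
proof (intro conjI allI impI)
  show "Min {u \<in> B. t v < t u} \<in> B" if "finite B \<and> (\<exists>u \<in> B. t v < t u)" for v B
  proof -
    have "Min {u \<in> B. t v < t u} \<in> {u \<in> B. t v < t u}"
      by (rule Min_in) (use that in auto)
    then show ?thesis by simp
  qed
  fix V E
  show "E \<in> weight_zero_trees t V \<longleftrightarrow> is_tree V E \<and> (\<forall>B \<in> components (V - {Min V}) E.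
      (\<exists>u \<in> B. t (Min V) < t u) \<and> {Min V, Min {u \<in> B. t (Min V) < t u}} \<in> E \<and>
      E \<inter> Pow B \<in> weight_zero_trees t B)" (is "_ \<longleftrightarrow> _ \<and> (\<forall>B \<in> ?K. ?P B)")
  proof (cases "is_tree V E")
    case False
    then show ?thesis by (simp add: weight_zero_trees_def)
  next
    case T: True
    then have V: "finite V" "V \<noteq> {}" unfolding is_tree_def by auto
    define v where "v = Min V"
    have v: "v \<in> V" using V by (simp add: v_def)
    have "\<forall>B \<in> ?K. \<exists>u. u \<in> B \<and> {v, u} \<in> E \<and> (\<forall>u'. u' \<in> B \<and> {v, u'} \<in> E \<longrightarrow> u' = u)"
      using tree_component_neighbour[OF T v] unfolding v_def by blast
    then obtain c where c: "\<And>B. B \<in> ?K \<Longrightarrow> c B \<in> B \<and> {v, c B} \<in> E"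
      and c': "\<And>B u'. B \<in> ?K \<Longrightarrow> u' \<in> B \<Longrightarrow> {v, u'} \<in> E \<Longrightarrow> u' = c B" by metis
    have the: "(THE u'. u' \<in> B \<and> {v, u'} \<in> E) = c B" if "B \<in> ?K" for B
      using c[OF that] c'[OF that] by blast
    have fin: "finite {u \<in> B. t v < t u}" if "B \<in> ?K" for B
      using component_props(2)[OF V that] by simp
    have Min_iff: "(\<exists>u \<in> B. t v < t u) \<and> {v, Min {u \<in> B. t v < t u}} \<in> E \<longleftrightarrow>
        t v < t (c B) \<and> {u \<in> B. t u > t v \<and> u < c B} = {}" if B: "B \<in> ?K" for B
    proof
      assume l: "(\<exists>u \<in> B. t v < t u) \<and> {v, Min {u \<in> B. t v < t u}} \<in> E"
      then have "Min {u \<in> B. t v < t u} \<in> {u \<in> B. t v < t u}"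
        by (intro Min_in fin[OF B]) blast
      moreover from this have "Min {u \<in> B. t v < t u} = c B" using c'[OF B] l by blast
      moreover have "\<And>u. u \<in> B \<Longrightarrow> t v < t u \<Longrightarrow> Min {u \<in> B. t v < t u} \<le> u"
        using fin[OF B] by simp
      ultimately show "t v < t (c B) \<and> {u \<in> B. t u > t v \<and> u < c B} = {}" by fastforce
    next
      assume r: "t v < t (c B) \<and> {u \<in> B. t u > t v \<and> u < c B} = {}"
      have "Min {u \<in> B. t v < t u} = c B"
        by (rule Min_eqI) (use r c[OF B] fin[OF B] in \<open>auto simp: not_less[symmetric]\<close>)
      then show "(\<exists>u \<in> B. t v < t u) \<and> {v, Min {u \<in> B. t v < t u}} \<in> E"
        using r c[OF B] by auto
    qed
    have tree_B: "is_tree B (E \<inter> Pow B)" if "B \<in> ?K" for B by (rule tree_component_tree[OF T that])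
    have weight_zero: "weight E t V = 0 \<longleftrightarrow>
      (\<forall>B \<in> ?K. {u \<in> B. t u > t v \<and> u < c B} = {} \<and> weight (E \<inter> Pow B) t B = 0)"
    proof -
      have "finite ?K" using V by (simp add: finite_components)
      then have "weight E t V = 0 \<longleftrightarrow>
        (\<forall>B \<in> ?K. card {u \<in> B. t u > t v \<and> u < (THE u'. u' \<in> B \<and> {v, u'} \<in> E)} + weight E t B = 0)"
        unfolding weight_eq[OF V] v_def by (simp only: sum_eq_0_iff)
      also have "\<dots> \<longleftrightarrow> (\<forall>B \<in> ?K. {u \<in> B. t u > t v \<and> u < c B} = {} \<and> weight (E \<inter> Pow B) t B = 0)"
      proof (rule ball_cong[OF refl])
        fix B assume B: "B \<in> ?K"
        have "finite {u \<in> B. t u > t v \<and> u < c B}" using component_props(2)[OF V B] by simp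
        then show "card {u \<in> B. t u > t v \<and> u < (THE u'. u' \<in> B \<and> {v, u'} \<in> E)} + weight E t B = 0 \<longleftrightarrow>
          {u \<in> B. t u > t v \<and> u < c B} = {} \<and> weight (E \<inter> Pow B) t B = 0"
          unfolding the[OF B] weight_restrict[OF subset_refl] by (simp only: add_is_0 card_0_eq)
      qed
      finally show ?thesis .
    qed
    have "tiered E t \<longleftrightarrow> (\<forall>B \<in> ?K. t v < t (c B) \<and> tiered (E \<inter> Pow B) t)"
    proof
      assume ti: "tiered E t"
      have "t v < t (c B)" if B: "B \<in> ?K" for B
      proof -
        have "v < c B" "{c B, v} \<in> E"
          using component_props(5)[OF V B] c[OF B] by (auto simp: v_def insert_commute)
        then show ?thesis using ti unfolding tiered_def by blast
      qed
      then show "\<forall>B \<in> ?K. t v < t (c B) \<and> tiered (E \<inter> Pow B) t"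
        using tiered_subset[OF ti] by blast
    next
      assume "\<forall>B \<in> ?K. t v < t (c B) \<and> tiered (E \<inter> Pow B) t"
      then show "tiered E t"
        using c unfolding v_def by (intro tiered_if_components_tiered[OF T, of c]) blast
    qed
    with T have "E \<in> weight_zero_trees t V \<longleftrightarrow>
        (\<forall>B \<in> ?K. t v < t (c B) \<and> tiered (E \<inter> Pow B) t) \<and>
        (\<forall>B \<in> ?K. {u \<in> B. t u > t v \<and> u < c B} = {} \<and> weight (E \<inter> Pow B) t B = 0)"
      unfolding weight_zero_trees_def mem_Collect_eq weight_zero by (simp only: simp_thms)
    also have "\<dots> \<longleftrightarrow> (\<forall>B \<in> ?K. (t v < t (c B) \<and> {u \<in> B. t u > t v \<and> u < c B} = {}) \<and>
        tiered (E \<inter> Pow B) t \<and> weight (E \<inter> Pow B) t B = 0)"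
      by (simp only: ball_conj_distrib conj_ac)
    also have "\<dots> \<longleftrightarrow> (\<forall>B \<in> ?K. ?P B)"
    proof (rule ball_cong[OF refl])
      fix B assume B: "B \<in> ?K"
      show "(t v < t (c B) \<and> {u \<in> B. t u > t v \<and> u < c B} = {}) \<and>
          tiered (E \<inter> Pow B) t \<and> weight (E \<inter> Pow B) t B = 0 \<longleftrightarrow> ?P B"
        using tree_B[OF B] Min_iff[OF B] unfolding weight_zero_trees_def mem_Collect_eq v_def
        by (simp only: simp_thms conj_assoc[symmetric])
    qed
    finally show ?thesis using T by (simp only: simp_thms)
  qed
qed

section \<open>Unambiguous trees\<close>

text \<open>The pair \<open>(v, w)\<close> stands for the cell in column \<open>v\<close> and in the row of the leaf of column \<open>w\<close>. Rows
  are ordered by decreasing \<open>t\<close>, so \<open>t w < t w'\<close> means that the row of \<open>w'\<close> comes first.\<close>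

definition cells :: "nat set \<Rightarrow> nat set set \<Rightarrow> (nat \<times> nat) set" where
  "cells V E = {(v, v) |v. v \<in> V} \<union> {(v, w). v < w \<and> {v, w} \<in> E}"

text \<open>This is the "not both" half of the condition on points: \<open>x' < x\<close> puts
  \<open>(x', y)\<close> to the left of \<open>(x, y)\<close>, while \<open>t y < t y'\<close> would
  put \<open>(x, y')\<close> above it.\<close>

definition unambiguous :: "(nat \<Rightarrow> nat) \<Rightarrow> (nat \<times> nat) set \<Rightarrow> bool" where
  "unambiguous t C \<longleftrightarrow>
     (\<forall>x y x' y'. (x, y) \<in> C \<and> (x', y) \<in> C \<and> x' < x \<and> (x, y') \<in> C \<longrightarrow> t y' \<le> t y)"

text \<open>This is the "at least one" half: a cell with nothing to its left and nothing above it
  must be the corner, in the first column and the row of the largest tier.\<close>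

definition singly_rooted :: "(nat \<Rightarrow> nat) \<Rightarrow> nat set \<Rightarrow> (nat \<times> nat) set \<Rightarrow> bool" where
  "singly_rooted t V C \<longleftrightarrow>
     (\<forall>x y. (x, y) \<in> C \<and> (\<forall>x'. (x', y) \<in> C \<longrightarrow> x \<le> x') \<and> (\<forall>y'. (x, y') \<in> C \<longrightarrow> t y' \<le> t y)
        \<longrightarrow> x = Min V \<and> t y = Max (t ` V))"

lemma cells_subset: "(\<And>e. e \<in> E \<Longrightarrow> e \<subseteq> V) \<Longrightarrow> cells V E \<subseteq> V \<times> V"
  unfolding cells_def by blast

lemma cells_restrict_subset: "B \<subseteq> V \<Longrightarrow> cells B (E \<inter> Pow B) \<subseteq> cells V E"
  unfolding cells_def by blast

lemma cells_restrict_square: "cells B (E \<inter> Pow B) \<subseteq> B \<times> B"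
  by (rule cells_subset) blast

lemma unambiguous_subset: "unambiguous t C \<Longrightarrow> C' \<subseteq> C \<Longrightarrow> unambiguous t C'"
  unfolding unambiguous_def by blast

lemma cells_tree_cases:
  assumes T: "is_tree V E"
    and c: "\<And>B. B \<in> components (V - {Min V}) E \<Longrightarrow> c B \<in> B \<and> {Min V, c B} \<in> E"
    and xy: "(x, y) \<in> cells V E"
  obtains "x = Min V" "y = Min V"
  | B where "B \<in> components (V - {Min V}) E" "x = Min V" "y = c B"
  | B where "B \<in> components (V - {Min V}) E" "(x, y) \<in> cells B (E \<inter> Pow B)"
proof -
  let ?K = "components (V - {Min V}) E"
  have V: "finite V" "V \<noteq> {}" using T unfolding is_tree_def by auto
  have cover: "\<Union> ?K = V - {Min V}"
    using partition_on_components by (metis partition_onD1)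
  from xy consider "x = y" "x \<in> V" | "x < y" "{x, y} \<in> E" unfolding cells_def by auto
  then show thesis
  proof cases
    case 1
    show thesis
    proof (cases "x = Min V")
      case True
      with 1 have "y = Min V" by simp
      with True show thesis by (rule that(1))
    next
      case False
      then obtain B where B: "B \<in> ?K" "x \<in> B" using cover 1(2) by blast
      with 1 have "(x, y) \<in> cells B (E \<inter> Pow B)" unfolding cells_def by simp
      with B(1) show thesis by (rule that(3))
    qed
  next
    case 2
    from T 2(2) show thesis
    proof (cases rule: tree_edge_cases[where v = "Min V"])
      case (1 B)
      with 2 have "(x, y) \<in> cells B (E \<inter> Pow B)" unfolding cells_def by simp
      with 1(1) show thesis by (rule that(3))
    next
      case B: (2 B u)
      then have "{Min V, u} \<in> E" using 2 by simp
      then have u: "u = c B"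
        using tree_component_neighbour[OF T Min_in[OF V] B(1)] c[OF B(1)] B(2) by blast
      have "Min V < u" using component_props(5)[OF V B(1,2)] .
      then have "x = Min V" "y = u" using B(3) 2(1) by (auto simp: doubleton_eq_iff)
      then show thesis using that(2)[OF B(1)] u by simp
    qed
  qed
qed

text \<open>All cells outside the column of \<open>Min V\<close> lie in the squares
  \<open>B \<times> B\<close>, and the new cell \<open>(Min V, c B)\<close> extends the row of
  \<open>c B\<close> to the left. Because this is the top row of \<open>B\<close>, no cell in that
  row has another one above it, so no ambiguity arises; and the root cell of \<open>B\<close>, which
  lies in this row, now has a predecessor.\<close>

lemma cells_from_components:
  assumes T: "is_tree V E" and inj: "inj t"
    and c: "\<And>B. B \<in> components (V - {Min V}) E \<Longrightarrow> c B \<in> B \<and> {Min V, c B} \<in> E"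
    and top: "\<And>B. B \<in> components (V - {Min V}) E \<Longrightarrow> t (c B) = Max (t ` B)"
    and U: "\<And>B. B \<in> components (V - {Min V}) E \<Longrightarrow> unambiguous t (cells B (E \<inter> Pow B))"
    and R: "\<And>B. B \<in> components (V - {Min V}) E \<Longrightarrow> singly_rooted t B (cells B (E \<inter> Pow B))"
  shows "unambiguous t (cells V E)" "singly_rooted t V (cells V E)"
proof -
  let ?K = "components (V - {Min V}) E"
  have V: "finite V" "V \<noteq> {}" using T unfolding is_tree_def by auto
  have CV: "cells V E \<subseteq> V \<times> V" by (rule cells_subset) (use T in \<open>auto simp: is_tree_def\<close>)
  have part: "partition_on (V - {Min V}) ?K" by (rule partition_on_components)
  have disj: "B = B'" if "B \<in> ?K" "B' \<in> ?K" "x \<in> B" "x \<in> B'" for B B' x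
    using part that unfolding partition_on_def disjoint_def by blast
  have sq: "x \<in> B" "y \<in> B" if "(x, y) \<in> cells B (E \<inter> Pow B)" for x y B
    using that cells_restrict_square by blast+
  have lt: "Min V < x" if "B \<in> ?K" "x \<in> B" for B x using component_props(5)[OF V that] .
  have tB: "t y \<le> t (c B)" if "B \<in> ?K" "y \<in> B" for B y
    using top[OF that(1)] that component_props(2)[OF V that(1)] by simp
  have inside: thesis
    if xy: "(x, y) \<in> cells V E" and x: "x \<noteq> Min V"
      and B: "\<And>B. B \<in> ?K \<Longrightarrow> (x, y) \<in> cells B (E \<inter> Pow B) \<Longrightarrow> thesis" for x y thesis
    by (rule cells_tree_cases[OF T c xy]) (use x B in auto)
  show "unambiguous t (cells V E)"
    unfolding unambiguous_def
  proof (intro allI impI)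
    fix x y x' y'
    assume as: "(x, y) \<in> cells V E \<and> (x', y) \<in> cells V E \<and> x' < x \<and> (x, y') \<in> cells V E"
    have "x' \<in> V" using as CV by blast
    then have "Min V < x" using V as by (meson Min_le le_less_trans)
    then have x: "x \<noteq> Min V" by simp
    have as': "(x, y) \<in> cells V E" "(x', y) \<in> cells V E" "(x, y') \<in> cells V E" using as by blast+
    obtain B where B: "B \<in> ?K" "(x, y) \<in> cells B (E \<inter> Pow B)"
      using inside[OF as'(1) x] .
    obtain B' where B': "B' \<in> ?K" "(x, y') \<in> cells B' (E \<inter> Pow B')"
      using inside[OF as'(3) x] .
    have "B' = B" using disj[OF B'(1) B(1)] sq B B' by blast
    show "t y' \<le> t y"
    proof (rule cells_tree_cases[OF T c as'(2)])
      assume "y = Min V"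
      then show ?thesis using lt[OF B(1) sq(2)[OF B(2)]] by simp
    next
      \<comment> \<open>The left predecessor is the new cell of the block, so \<open>y\<close> is
        the top row of \<open>B\<close> and nothing in column \<open>x\<close> lies above
        it.\<close>
      fix B'' assume B'': "B'' \<in> ?K" "y = c B''"
      then have "B'' = B" using disj[OF B''(1) B(1), of y] c[OF B''(1)] sq(2)[OF B(2)] by simp
      then show ?thesis using B'' tB[OF B(1)] sq(2)[OF B'(2)] \<open>B' = B\<close> by simp
    next
      fix B'' assume B'': "B'' \<in> ?K" "(x', y) \<in> cells B'' (E \<inter> Pow B'')"
      then have "B'' = B" using disj[OF B''(1) B(1) sq(2)[OF B''(2)] sq(2)[OF B(2)]] by simp
      then have "(x', y) \<in> cells B (E \<inter> Pow B)" "(x, y') \<in> cells B (E \<inter> Pow B)"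
        using B'' B' \<open>B' = B\<close> by simp_all
      then show ?thesis
        using U[OF B(1)] B(2) as unfolding unambiguous_def by blast
    qed
  qed
  show "singly_rooted t V (cells V E)"
    unfolding singly_rooted_def
  proof (intro allI impI)
    fix x y
    assume as: "(x, y) \<in> cells V E \<and> (\<forall>x'. (x', y) \<in> cells V E \<longrightarrow> x \<le> x') \<and>
      (\<forall>y'. (x, y') \<in> cells V E \<longrightarrow> t y' \<le> t y)"
    have vc: "(Min V, c B) \<in> cells V E" if "B \<in> ?K" for B
      using c[OF that] lt[OF that] unfolding cells_def by blast
    have "x = Min V"
    proof (rule ccontr)
      assume "x \<noteq> Min V"
      then obtain B where B: "B \<in> ?K" "(x, y) \<in> cells B (E \<inter> Pow B)"
        using inside[OF conjunct1[OF as]] by blast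
      have "cells B (E \<inter> Pow B) \<subseteq> cells V E"
        by (rule cells_restrict_subset) (rule component_props(1)[OF V B(1)])
      \<comment> \<open>Having no predecessor in \<open>cells V E\<close>, the cell has none in
        \<open>B\<close> either, hence it is the root cell of \<open>B\<close>.\<close>
      then have "t y = Max (t ` B)"
        using R[OF B(1)] B(2) as unfolding singly_rooted_def by blast
      then have "y = c B" using top[OF B(1)] injD[OF inj, of y "c B"] by simp
      then have "x \<le> Min V" using vc[OF B(1)] as by blast
      then show False using lt[OF B(1) sq(1)[OF B(2)]] by simp
    qed
    moreover have "t y = Max (t ` V)"
    \<comment> \<open>The column of \<open>Min V\<close> meets the top row of every block, so its
      topmost cell has the largest tier of all.\<close>
    proof (rule Max_eqI[symmetric])
      show "finite (t ` V)" using V by simp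
      show "t y \<in> t ` V" using as CV by blast
      fix s assume "s \<in> t ` V"
      then obtain z where z: "z \<in> V" "s = t z" by blast
      show "s \<le> t y"
      proof (cases "z = Min V")
        case True
        have "(Min V, Min V) \<in> cells V E" using V by (simp add: cells_def)
        then show ?thesis using as \<open>x = Min V\<close> z True by blast
      next
        case False
        then obtain B where B: "B \<in> ?K" "z \<in> B" using z part by (metis DiffI UnionE partition_onD1 singletonD)
        then have "t (c B) \<le> t y" using vc[OF B(1)] as \<open>x = Min V\<close> by blast
        with tB[OF B] z show ?thesis by simp
      qed
    qed
    ultimately show "x = Min V \<and> t y = Max (t ` V)" by blast
  qed
qed

definition unambiguous_trees :: "(nat \<Rightarrow> nat) \<Rightarrow> nat set \<Rightarrow> nat set set set" where
  "unambiguous_trees t V = {E. is_tree V E \<and> tiered E t \<and> unambiguous t (cells V E)}"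

lemma unambiguous_trees_component:
  assumes E: "E \<in> unambiguous_trees t V" and B: "B \<in> components (V - {Min V}) E"
  shows "E \<inter> Pow B \<in> unambiguous_trees t B"
proof -
  have T: "is_tree V E" using E by (simp add: unambiguous_trees_def)
  then have "B \<subseteq> V" using component_props(1)[OF _ _ B] unfolding is_tree_def by simp
  then show ?thesis
    using E tree_component_tree[OF T B] unfolding unambiguous_trees_def
    by (auto intro: tiered_subset unambiguous_subset dest: cells_restrict_subset)
qed

lemma neighbour_is_top:
  assumes E: "E \<in> unambiguous_trees t V" and B: "B \<in> components (V - {Min V}) E"
    and R: "singly_rooted t B (cells B (E \<inter> Pow B))"
    and u: "u \<in> B" "{Min V, u} \<in> E"
  shows "t u = Max (t ` B)"
proof -
  have T: "is_tree V E" and U: "unambiguous t (cells V E)"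
    using E by (simp_all add: unambiguous_trees_def)
  have V: "finite V" "V \<noteq> {}" using T unfolding is_tree_def by auto
  note BV = component_props[OF V B]
  have sub: "cells B (E \<inter> Pow B) \<subseteq> cells V E" by (rule cells_restrict_subset[OF BV(1)])
  \<comment> \<open>The cell \<open>(Min V, u)\<close> precedes the row of \<open>u\<close>, so in the first cell of that row inside \<open>B\<close>
    nothing lies above, and by uniqueness of the root this is the root cell of \<open>B\<close>.\<close>
  define x where "x = (LEAST x. (x, u) \<in> cells B (E \<inter> Pow B))"
  have "(u, u) \<in> cells B (E \<inter> Pow B)" using u by (simp add: cells_def)
  then have x: "(x, u) \<in> cells B (E \<inter> Pow B)" unfolding x_def by (rule LeastI)
  have least: "x \<le> x'" if "(x', u) \<in> cells B (E \<inter> Pow B)" for x'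
    using that unfolding x_def by (rule Least_le)
  have "Min V < x" using x cells_restrict_square BV(5) by blast
  moreover have "(Min V, u) \<in> cells V E" using u BV(5) unfolding cells_def by blast
  ultimately have "t y' \<le> t u" if "(x, y') \<in> cells B (E \<inter> Pow B)" for y'
    using U x that sub unfolding unambiguous_def by blast
  with R x least show ?thesis unfolding singly_rooted_def by blast
qed

text \<open>By induction each block has a single root, which forces the neighbour of
  \<open>Min V\<close> in the block to be its top vertex; under this condition the single root
  passes from the blocks to \<open>V\<close>.\<close>

lemma unambiguous_trees_singly_rooted:
  assumes "inj t" "E \<in> unambiguous_trees t V"
  shows "singly_rooted t V (cells V E)"
  using assms(2)
proof (induction "card V" arbitrary: V E rule: less_induct)
  case less
  have T: "is_tree V E" using less.prems by (simp add: unambiguous_trees_def)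
  then have V: "finite V" "V \<noteq> {}" unfolding is_tree_def by auto
  let ?K = "components (V - {Min V}) E"
  have "\<forall>B \<in> ?K. \<exists>u. u \<in> B \<and> {Min V, u} \<in> E"
    using tree_component_neighbour[OF T Min_in[OF V]] by blast
  then obtain c where c: "\<And>B. B \<in> ?K \<Longrightarrow> c B \<in> B \<and> {Min V, c B} \<in> E" by metis
  have EB: "E \<inter> Pow B \<in> unambiguous_trees t B" if "B \<in> ?K" for B
    by (rule unambiguous_trees_component[OF less.prems that])
  have R: "singly_rooted t B (cells B (E \<inter> Pow B))" if "B \<in> ?K" for B
    by (rule less.hyps[OF component_props(4)[OF V that] EB[OF that]])
  show ?case
  proof (rule cells_from_components(2)[OF T assms(1) c])
    show "t (c B) = Max (t ` B)" if "B \<in> ?K" for B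
      using neighbour_is_top[OF less.prems that R[OF that]] c[OF that] by blast
    show "unambiguous t (cells B (E \<inter> Pow B))" if "B \<in> ?K" for B
      using EB[OF that] by (simp add: unambiguous_trees_def)
  qed (use R in auto)
qed

lemma recursive_unambiguous_trees:
  assumes inj: "inj t"
  shows "recursive_trees t (\<lambda>_ B. inv_into B t (Max (t ` B))) (unambiguous_trees t)"
  unfolding recursive_trees_def
proof (intro conjI allI impI)
  have top: "inv_into B t (Max (t ` B)) \<in> B" "t (inv_into B t (Max (t ` B))) = Max (t ` B)"
    if "finite B" "B \<noteq> {}" for B
    using Max_in[of "t ` B"] that by (intro inv_into_into f_inv_into_f; simp)+
  show "inv_into B t (Max (t ` B)) \<in> B" if "finite B \<and> (\<exists>u \<in> B. t v < t u)" for v B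
    using that top(1)[of B] by blast
  fix V E
  show "E \<in> unambiguous_trees t V \<longleftrightarrow> is_tree V E \<and> (\<forall>B \<in> components (V - {Min V}) E.
      (\<exists>u \<in> B. t (Min V) < t u) \<and> {Min V, inv_into B t (Max (t ` B))} \<in> E \<and>
      E \<inter> Pow B \<in> unambiguous_trees t B)" (is "_ \<longleftrightarrow> _ \<and> (\<forall>B \<in> ?K. ?P B)")
  proof
    assume E: "E \<in> unambiguous_trees t V"
    then have T: "is_tree V E" and ti: "tiered E t" by (simp_all add: unambiguous_trees_def)
    then have V: "finite V" "V \<noteq> {}" unfolding is_tree_def by auto
    have "?P B" if B: "B \<in> ?K" for B
    proof -
      note BV = component_props[OF V B]
      obtain u where u: "u \<in> B" "{Min V, u} \<in> E"
        using tree_component_neighbour[OF T Min_in[OF V] B] by blast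
      have EB: "E \<inter> Pow B \<in> unambiguous_trees t B" by (rule unambiguous_trees_component[OF E B])
      have "t u = Max (t ` B)"
        using neighbour_is_top[OF E B unambiguous_trees_singly_rooted[OF inj EB] u] .
      then have "inv_into B t (Max (t ` B)) = u"
        using u inj by (metis inj_on_subset inv_into_f_f subset_UNIV)
      moreover have "t (Min V) < t u"
        using ti u BV(5)[OF u(1)] unfolding tiered_def by (metis insert_commute)
      ultimately show ?thesis using u EB by auto
    qed
    with T show "is_tree V E \<and> (\<forall>B \<in> ?K. ?P B)" by blast
  next
    assume as: "is_tree V E \<and> (\<forall>B \<in> ?K. ?P B)"
    then have T: "is_tree V E" by blast
    then have V: "finite V" "V \<noteq> {}" unfolding is_tree_def by auto
    let ?c = "\<lambda>B. inv_into B t (Max (t ` B))"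
    have P: "\<exists>u \<in> B. t (Min V) < t u" "{Min V, ?c B} \<in> E" "E \<inter> Pow B \<in> unambiguous_trees t B"
      if "B \<in> ?K" for B using as that by blast+
    note BV = component_props[OF V]
    have c: "?c B \<in> B \<and> {Min V, ?c B} \<in> E" and cM: "t (?c B) = Max (t ` B)" if "B \<in> ?K" for B
      using top BV(2,3)[OF that] P(2)[OF that] by blast+
    have "unambiguous t (cells V E)"
    proof (rule cells_from_components(1)[OF T inj c])
      show "unambiguous t (cells B (E \<inter> Pow B))" if "B \<in> ?K" for B
        using P(3)[OF that] by (simp add: unambiguous_trees_def)
      show "singly_rooted t B (cells B (E \<inter> Pow B))" if "B \<in> ?K" for B
        by (rule unambiguous_trees_singly_rooted[OF inj P(3)[OF that]])
    qed (use cM in auto)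
    moreover have "tiered E t"
    proof (rule tiered_if_components_tiered[OF T, of ?c])
      fix B assume B: "B \<in> ?K"
      obtain u where "u \<in> B" "t (Min V) < t u" using P(1)[OF B] by blast
      moreover have "t u \<le> t (?c B)" using cM[OF B] BV(2)[OF B] \<open>u \<in> B\<close> by simp
      ultimately show "?c B \<in> B \<and> t (Min V) < t (?c B) \<and> {Min V, ?c B} \<in> E \<and> tiered (E \<inter> Pow B) t"
        using c[OF B] P(3)[OF B] by (simp add: unambiguous_trees_def)
    qed
    ultimately show "E \<in> unambiguous_trees t V" using T by (simp add: unambiguous_trees_def)
  qed
qed

section \<open>Unambiguous graphs have no cycles\<close>

lemma cycle_two_neighbours:
  assumes "is_cycle E vs"
  obtains F where "F \<subseteq> E" "finite F" "F \<noteq> {}"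
    "\<And>a b. {a, b} \<in> F \<Longrightarrow> \<exists>c. c \<noteq> b \<and> {a, c} \<in> F"
proof -
  let ?l = "length vs"
  have vs: "?l \<ge> 3" "distinct vs" and ed: "\<And>i. i < ?l \<Longrightarrow> {vs ! i, vs ! (Suc i mod ?l)} \<in> E"
    using assms unfolding is_cycle_def by auto
  have l0: "0 < ?l" using vs by linarith
  \<comment> \<open>The edge set of the cycle forgets the cyclic order; that every vertex on it has
    two neighbours within \<open>F\<close> is all that the extremal argument below needs.\<close>
  define F where "F = (\<lambda>i. {vs ! i, vs ! (Suc i mod ?l)}) ` {..<?l}"
  have two: "\<exists>p s. p \<noteq> s \<and> {vs ! j, p} \<in> F \<and> {vs ! j, s} \<in> F" if j: "j < ?l" for j
  proof -
    \<comment> \<open>The cyclic predecessor of \<open>j\<close>. It differs from the successor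
      because the cycle has at least three vertices.\<close>
    define i where "i = (if j = 0 then ?l - 1 else j - 1)"
    have i: "i < ?l" "Suc i mod ?l = j" using j l0 by (auto simp: i_def)
    have "i \<noteq> Suc j mod ?l"
      using vs(1) j by (auto simp: i_def mod_Suc split: if_splits)
    then have "vs ! i \<noteq> vs ! (Suc j mod ?l)"
      using vs(2) i(1) l0 by (simp add: nth_eq_iff_index_eq)
    moreover have "{vs ! j, vs ! (Suc j mod ?l)} \<in> F" using j unfolding F_def by blast
    moreover have "{vs ! i, vs ! (Suc i mod ?l)} \<in> F" using i(1) unfolding F_def by blast
    then have "{vs ! j, vs ! i} \<in> F" unfolding i(2) by (simp add: insert_commute)
    ultimately show ?thesis by blast
  qed
  show thesis
  proof
    show "F \<subseteq> E" using ed unfolding F_def by blast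
    show "finite F" unfolding F_def by simp
    show "F \<noteq> {}" using l0 unfolding F_def by blast
    fix a b assume "{a, b} \<in> F"
    then obtain i where i: "i < ?l" "{a, b} = {vs ! i, vs ! (Suc i mod ?l)}"
      unfolding F_def by blast
    then have "a = vs ! i \<or> a = vs ! (Suc i mod ?l)" by blast
    moreover have "Suc i mod ?l < ?l" using l0 by simp
    ultimately obtain j where "j < ?l" "a = vs ! j" using i(1) by blast
    then show "\<exists>c. c \<noteq> b \<and> {a, c} \<in> F" using two by metis
  qed
qed

lemma acyclic_if_unambiguous:
  assumes inj: "inj t" and edges: "\<And>e. e \<in> E \<Longrightarrow> e \<subseteq> V \<and> card e = 2"
    and ti: "tiered E t" and U: "unambiguous t (cells V E)"
  shows "\<nexists>vs. is_cycle E vs"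
proof
  assume "\<exists>vs. is_cycle E vs"
  then obtain F where F: "F \<subseteq> E" "finite F" "F \<noteq> {}"
    and two: "\<And>a b. {a, b} \<in> F \<Longrightarrow> \<exists>c. c \<noteq> b \<and> {a, c} \<in> F"
    by (metis cycle_two_neighbours)
  have ne: "a \<noteq> b" if "{a, b} \<in> F" for a b using edges[of "{a, b}"] F(1) that by fastforce
  have cell: "(a, b) \<in> cells V E" if "{a, b} \<in> F" "a < b" for a b
    using that F(1) unfolding cells_def by blast
  \<comment> \<open>An edge whose smaller end is as large as possible leads to an ambiguous cell.\<close>
  define w where "w = Max (Min ` F)"
  have finF: "finite (Min ` F)" "Min ` F \<noteq> {}" using F by simp_all
  have "w \<in> Min ` F" unfolding w_def by (rule Max_in[OF finF])
  then obtain e where e: "e \<in> F" "w = Min e" by blast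
  then have "card e = 2" using edges F(1) by blast
  then obtain a b where ab: "e = {a, b}" "a < b"
    by (metis card_2_iff insert_commute nat_neq_iff)
  then have wz: "{w, b} \<in> F" "w < b" using e by auto
  have maxw: "x \<le> w" if "{x, y} \<in> F" "x < y" for x y
  proof -
    have "Min {x, y} \<le> w" unfolding w_def using finF(1) imageI[OF that(1), of Min] by (rule Max_ge)
    then show ?thesis using that(2) by simp
  qed
  \<comment> \<open>The second neighbour \<open>z'\<close> of \<open>z\<close> is smaller than
    \<open>z\<close> by the choice of \<open>w\<close>, and then smaller than \<open>w\<close> for
    the same reason. So \<open>(z', z)\<close> lies to the left of \<open>(w, z)\<close>, and
    nothing in column \<open>w\<close> lies above the latter.\<close>
  have row: "t y \<le> t z" if z: "{w, z} \<in> F" "w < z" and y: "(w, y) \<in> cells V E" for y z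
  proof -
    have "{z, w} \<in> F" using z(1) by (simp add: insert_commute)
    then obtain z' where z': "z' \<noteq> w" "{z, z'} \<in> F" using two by blast
    have "\<not> z < z'" using maxw[OF z'(2)] z(2) by auto
    then have "z' < z" using ne[OF z'(2)] by simp
    moreover have zz: "{z', z} \<in> F" using z'(2) by (simp add: insert_commute)
    ultimately have "z' < w" using maxw[of z' z] z'(1) by simp
    with cell[OF zz \<open>z' < z\<close>] cell[OF z] y U show ?thesis unfolding unambiguous_def by blast
  qed
  \<comment> \<open>If the second neighbour \<open>z\<close> of \<open>w\<close> is larger than
    \<open>w\<close>, then both \<open>b\<close> and \<open>z\<close> give the topmost cell of
    column \<open>w\<close>. If it is smaller, the leaf \<open>(w, w)\<close> has
    \<open>(z, w)\<close> to its left and \<open>(w, b)\<close> above it.\<close>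
  obtain z where z: "z \<noteq> b" "{w, z} \<in> F" using two[OF wz(1)] by blast
  show False
  proof (cases "w < z")
    case True
    have "t b \<le> t z" by (rule row[OF z(2) True cell[OF wz]])
    moreover have "t z \<le> t b" by (rule row[OF wz cell[OF z(2) True]])
    ultimately show False using inj z(1) by (simp add: inj_eq)
  next
    case False
    then have zw: "z < w" using ne[OF z(2)] by simp
    have "w \<in> V" using edges[of "{w, b}"] wz F(1) by blast
    then have "(w, w) \<in> cells V E" by (simp add: cells_def)
    moreover have "(z, w) \<in> cells V E" using cell[of z w] z(2) zw by (simp add: insert_commute)
    ultimately have "t b \<le> t w" using U zw cell[OF wz] unfolding unambiguous_def by blast
    moreover have "t w < t b" using ti wz F(1) unfolding tiered_def by (metis insert_commute subsetD)
    ultimately show False by simp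
  qed
qed

section \<open>Children and completeness in terms of rows and columns\<close>

definition row_after :: "(nat \<times> nat) set \<Rightarrow> nat \<times> nat \<Rightarrow> (nat \<times> nat) set" where
  "row_after A q = {p \<in> A. snd p = snd q \<and> fst q < fst p}"

definition col_after :: "(nat \<times> nat) set \<Rightarrow> nat \<times> nat \<Rightarrow> (nat \<times> nat) set" where
  "col_after A q = {p \<in> A. fst p = fst q \<and> snd q < snd p}"

lemma row_children:
  assumes A: "\<And>p. p \<in> A \<Longrightarrow> fst p > 0 \<and> snd p > 0" and q: "q \<in> A"
  defines "R \<equiv> {p \<in> A. p \<noteq> (1, 1) \<and> q \<in> row_before A p \<and> (\<forall>r \<in> row_before A p. fst r \<le> fst q)}"
  shows "R \<subseteq> row_after A q" "card R = (if row_after A q = {} then 0 else 1)"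
proof -
  show sub: "R \<subseteq> row_after A q" unfolding R_def row_after_def row_before_def by auto
  show "card R = (if row_after A q = {} then 0 else 1)"
  proof (cases "row_after A q = {}")
    case True
    with sub show ?thesis by auto
  next
    case False
    define a where "a = (LEAST a. fst q < a \<and> (a, snd q) \<in> A)"
    obtain p where "p \<in> row_after A q" using False by blast
    then have "fst q < fst p \<and> (fst p, snd q) \<in> A"
      unfolding row_after_def by (metis (mono_tags, lifting) mem_Collect_eq prod.collapse)
    then have a: "fst q < a \<and> (a, snd q) \<in> A" unfolding a_def by (rule LeastI)
    have least: "a \<le> b" if "fst q < b" "(b, snd q) \<in> A" for b
      unfolding a_def using that by (intro Least_le) simp
    have "R = {(a, snd q)}"
    proof
      \<comment> \<open>Positivity of \<open>q\<close> gives \<open>1 < a\<close>, so this point is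
        not the root and does have a parent.\<close>
      show "{(a, snd q)} \<subseteq> R"
        unfolding R_def row_before_def using a q A[OF q] least by (force simp: not_less[symmetric])
      show "R \<subseteq> {(a, snd q)}"
      proof
        fix p assume p: "p \<in> R"
        then have p': "p \<in> A" "snd p = snd q" "fst q < fst p"
          "\<And>r. r \<in> A \<Longrightarrow> snd r = snd p \<Longrightarrow> fst r < fst p \<Longrightarrow> fst r \<le> fst q"
          unfolding R_def row_before_def by auto
        have "(fst p, snd q) \<in> A" using p' by (metis prod.collapse)
        then have "a \<le> fst p" using least p'(3) by blast
        moreover have "\<not> a < fst p" using p'(4)[of "(a, snd q)"] a p'(2) by auto
        ultimately show "p \<in> {(a, snd q)}" using p'(2) by (simp add: prod_eq_iff)
      qed
    qed
    with False show ?thesis by simp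
  qed
qed

text \<open>Transposing the point set by \<open>prod.swap\<close> turns columns into rows.\<close>

lemma col_children:
  assumes A: "\<And>p. p \<in> A \<Longrightarrow> fst p > 0 \<and> snd p > 0" and q: "q \<in> A"
  defines "D \<equiv> {p \<in> A. p \<noteq> (1, 1) \<and> q \<in> col_before A p \<and> (\<forall>r \<in> col_before A p. snd r \<le> snd q)}"
  shows "D \<subseteq> col_after A q" "card D = (if col_after A q = {} then 0 else 1)"
proof -
  let ?s = "prod.swap"
  let ?A = "?s ` A"
  have row: "row_before ?A (?s p) = ?s ` col_before A p" for p
    unfolding row_before_def col_before_def by force
  have aft: "row_after ?A (?s p) = ?s ` col_after A p" for p
    unfolding row_after_def col_after_def by force
  let ?R = "{p \<in> ?A. p \<noteq> (1, 1) \<and> ?s q \<in> row_before ?A p \<and> (\<forall>r \<in> row_before ?A p. fst r \<le> fst (?s q))}"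
  have R: "?R = ?s ` D"
  proof -
    have "?R = ?s ` {p \<in> A. ?s p \<noteq> (1, 1) \<and> ?s q \<in> row_before ?A (?s p) \<and>
        (\<forall>r \<in> row_before ?A (?s p). fst r \<le> fst (?s q))}"
      by (rule Compr_image_eq)
    also have "\<dots> = ?s ` D"
      unfolding D_def row by (intro arg_cong[where f = "image ?s"] Collect_cong)
        (auto simp: prod.swap_def inj_image_mem_iff[OF inj_swap] prod_eq_iff)
    finally show ?thesis .
  qed
  have A': "\<And>p. p \<in> ?A \<Longrightarrow> fst p > 0 \<and> snd p > 0" using A by auto
  have q': "?s q \<in> ?A" using q by blast
  note rc = row_children[OF A' q', unfolded R aft]
  from rc(1) show "D \<subseteq> col_after A q" by (simp add: inj_image_subset_iff)
  from rc(2) show "card D = (if col_after A q = {} then 0 else 1)"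
    by (simp add: card_image)
qed

lemma card_children:
  assumes A: "\<And>p. p \<in> A \<Longrightarrow> fst p > 0 \<and> snd p > 0" and fin: "finite A" and q: "q \<in> A"
  shows "card (children A q) =
    (if row_after A q = {} then 0 else 1) + (if col_after A q = {} then 0 else 1)"
proof -
  let ?R = "{p \<in> A. p \<noteq> (1, 1) \<and> q \<in> row_before A p \<and> (\<forall>r \<in> row_before A p. fst r \<le> fst q)}"
  let ?D = "{p \<in> A. p \<noteq> (1, 1) \<and> q \<in> col_before A p \<and> (\<forall>r \<in> col_before A p. snd r \<le> snd q)}"
  have "children A q = ?R \<union> ?D" unfolding children_def is_parent_def by blast
  moreover have "?R \<inter> ?D = {}" unfolding row_before_def col_before_def by auto
  ultimately have "card (children A q) = card ?R + card ?D" using fin by (simp add: card_Un_disjoint)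
  then show ?thesis using row_children(2)[OF A q] col_children(2)[OF A q] by simp
qed

text \<open>A point has one child for each of the two directions in which a further point follows,
  so having 0 or 2 children means that both directions behave alike.\<close>

lemma complete_nonambiguous_tree_iff:
  "complete_nonambiguous_tree A \<longleftrightarrow>
     nonambiguous_tree A \<and> (\<forall>q \<in> A. row_after A q = {} \<longleftrightarrow> col_after A q = {})"
proof (cases "nonambiguous_tree A")
  case True
  then have A: "\<And>p. p \<in> A \<Longrightarrow> fst p > 0 \<and> snd p > 0" "finite A"
    unfolding nonambiguous_tree_def by auto
  have "(card (children A q) = 0 \<or> card (children A q) = 2) \<longleftrightarrow>
      (row_after A q = {} \<longleftrightarrow> col_after A q = {})" if "q \<in> A" for q
    using card_children[OF A that] by simp
  with True show ?thesis unfolding complete_nonambiguous_tree_def by simp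
next
  case False
  then show ?thesis unfolding complete_nonambiguous_tree_def by blast
qed

lemma internal_vertices_eq:
  assumes "complete_nonambiguous_tree A"
  shows "internal_vertices A = {q \<in> A. row_after A q \<noteq> {}}"
proof -
  have A: "\<And>p. p \<in> A \<Longrightarrow> fst p > 0 \<and> snd p > 0" "finite A"
    and R: "\<And>q. q \<in> A \<Longrightarrow> row_after A q = {} \<longleftrightarrow> col_after A q = {}"
    using assms unfolding complete_nonambiguous_tree_iff nonambiguous_tree_def by auto
  have fin: "finite (children A q)" for q
    using A(2) unfolding children_def by simp
  have "children A q = {} \<longleftrightarrow> row_after A q = {}" if "q \<in> A" for q
    using card_children[OF A that] R[OF that] card_0_eq[OF fin, of q] by (auto split: if_splits)
  then show ?thesis unfolding internal_vertices_def by blast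
qed

section \<open>Trees as point sets\<close>

text \<open>The subtraction reverses the tiers: tier \<open>n\<close> becomes row 1. Nothing is
  truncated as long as \<open>t\<close> permutes \<open>{1..n}\<close> and \<open>w\<close> lies in
  this interval.\<close>

definition point :: "nat \<Rightarrow> (nat \<Rightarrow> nat) \<Rightarrow> nat \<times> nat \<Rightarrow> nat \<times> nat" where
  "point n t = (\<lambda>(x, w). (x, Suc n - t w))"

definition point_set :: "nat \<Rightarrow> nat set set \<times> (nat \<Rightarrow> nat) \<Rightarrow> (nat \<times> nat) set" where
  "point_set n = (\<lambda>(E, t). point n t ` cells {1..n} E)"

lemma tieredD: "tiered E t \<Longrightarrow> {u, v} \<in> E \<Longrightarrow> u < v \<Longrightarrow> t u < t v"
  unfolding tiered_def by (metis insert_commute)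

lemma cells_le:
  assumes "tiered E t" "(a, b) \<in> cells V E"
  shows "a \<le> b" "t a \<le> t b"
proof -
  have "a = b \<or> a < b \<and> {a, b} \<in> E" using assms(2) unfolding cells_def by auto
  then show "a \<le> b" "t a \<le> t b" using tieredD[OF assms(1), of a b] by auto
qed

lemma permutes_flip:
  assumes "t permutes {1..n}" "v \<in> {1..n}" "w \<in> {1..n}"
  shows "Suc n - t v \<in> {1..n}"
    "Suc n - t v < Suc n - t w \<longleftrightarrow> t w < t v"
    "Suc n - t v \<le> Suc n - t w \<longleftrightarrow> t w \<le> t v"
    "Suc n - t v = Suc n - t w \<longleftrightarrow> v = w"
proof -
  have tv: "t v \<in> {1..n}" "t w \<in> {1..n}" using assms permutes_in_image by metis+
  then show "Suc n - t v \<in> {1..n}"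
    "Suc n - t v < Suc n - t w \<longleftrightarrow> t w < t v"
    "Suc n - t v \<le> Suc n - t w \<longleftrightarrow> t w \<le> t v" by auto
  have "Suc n - t v = Suc n - t w \<longleftrightarrow> t v = t w" using tv by auto
  also have "\<dots> \<longleftrightarrow> v = w" using permutes_inj[OF assms(1)] by (simp add: inj_eq)
  finally show "Suc n - t v = Suc n - t w \<longleftrightarrow> v = w" .
qed

lemma tree_cells_subset: "is_tree V E \<Longrightarrow> cells V E \<subseteq> V \<times> V"
  by (rule cells_subset) (simp add: is_tree_def)

lemma mem_point_set:
  "(x, y) \<in> point_set n (E, t) \<longleftrightarrow> (\<exists>w. (x, w) \<in> cells {1..n} E \<and> y = Suc n - t w)"
  unfolding point_set_def point_def by force

lemma mem_point_set_iff:
  assumes "is_tree {1..n} E" "t permutes {1..n}" "w \<in> {1..n}"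
  shows "(x, Suc n - t w) \<in> point_set n (E, t) \<longleftrightarrow> (x, w) \<in> cells {1..n} E"
proof -
  have "w = w'" if "(x, w') \<in> cells {1..n} E" "Suc n - t w = Suc n - t w'" for w'
    using permutes_flip(4)[OF assms(2,3), of w'] tree_cells_subset[OF assms(1)] that by auto
  then show ?thesis unfolding mem_point_set by metis
qed

text \<open>The leaf of \<open>w\<close> ends the row and the leaf of \<open>x\<close> ends the
  column. A cell with \<open>x \<noteq> w\<close> comes from an edge, so by tieredness both leaves
  come strictly after it; for \<open>x = w\<close> the cell is itself that leaf.\<close>

lemma point_set_internal:
  assumes T: "is_tree {1..n} E" and ti: "tiered E t" and t: "t permutes {1..n}"
    and xw: "(x, w) \<in> cells {1..n} E"
  shows "row_after (point_set n (E, t)) (x, Suc n - t w) \<noteq> {} \<longleftrightarrow> x \<noteq> w"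
    "col_after (point_set n (E, t)) (x, Suc n - t w) \<noteq> {} \<longleftrightarrow> x \<noteq> w"
proof -
  let ?A = "point_set n (E, t)"
  have V: "x \<in> {1..n}" "w \<in> {1..n}" using tree_cells_subset[OF T] xw by auto
  have leaf: "(v, Suc n - t v) \<in> ?A" if "v \<in> {1..n}" for v
    unfolding mem_point_set_iff[OF T t that] using that unfolding cells_def by blast
  have le: "t a \<le> t b" "a \<le> b" if "(a, b) \<in> cells {1..n} E" for a b
    using cells_le[OF ti that] by simp_all
  have lt: "t x < t w" "x < w" if "x \<noteq> w"
  proof -
    have "x < w \<and> {x, w} \<in> E" using xw that unfolding cells_def by auto
    then show "t x < t w" "x < w" using tieredD[OF ti] by simp_all
  qed
  show "row_after ?A (x, Suc n - t w) \<noteq> {} \<longleftrightarrow> x \<noteq> w"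
  proof
    assume "row_after ?A (x, Suc n - t w) \<noteq> {}"
    then obtain x' where x': "x < x'" "(x', Suc n - t w) \<in> ?A"
      unfolding row_after_def by auto
    then have "(x', w) \<in> cells {1..n} E" using mem_point_set_iff[OF T t V(2)] by blast
    then show "x \<noteq> w" using le(2) x'(1) by fastforce
  next
    assume "x \<noteq> w"
    then have "(w, Suc n - t w) \<in> row_after ?A (x, Suc n - t w)"
      using lt(2) leaf[OF V(2)] unfolding row_after_def by simp
    then show "row_after ?A (x, Suc n - t w) \<noteq> {}" by blast
  qed
  show "col_after ?A (x, Suc n - t w) \<noteq> {} \<longleftrightarrow> x \<noteq> w"
  proof
    assume "col_after ?A (x, Suc n - t w) \<noteq> {}"
    then obtain y where y: "Suc n - t w < y" "(x, y) \<in> ?A"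
      unfolding col_after_def by auto
    then obtain w' where w': "(x, w') \<in> cells {1..n} E" "y = Suc n - t w'"
      unfolding mem_point_set by blast
    have "w' \<in> {1..n}" using tree_cells_subset[OF T] w'(1) by auto
    then have "t w' < t w" using permutes_flip(2)[OF t V(2), of w'] y(1) w'(2) by simp
    then show "x \<noteq> w" using le(1)[OF w'(1)] by auto
  next
    assume "x \<noteq> w"
    then have "(x, Suc n - t x) \<in> col_after ?A (x, Suc n - t w)"
      using lt(1) leaf[OF V(1)] permutes_flip(2)[OF t V(2,1)] unfolding col_after_def by simp
    then show "col_after ?A (x, Suc n - t w) \<noteq> {}" by blast
  qed
qed

text \<open>Unambiguity excludes two predecessors, the single root excludes having none, and the
  leaves ensure that no row or column is empty.\<close>

lemma point_set_nonambiguous: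
  assumes n: "n \<ge> 1" and t: "t permutes {1..n}" and E: "E \<in> unambiguous_trees t {1..n}"
  shows "nonambiguous_tree (point_set n (E, t))"
proof -
  let ?V = "{1..n}" and ?A = "point_set n (E, t)"
  let ?C = "cells ?V E"
  have T: "is_tree ?V E" and U: "unambiguous t ?C"
    using E by (simp_all add: unambiguous_trees_def)
  have R: "singly_rooted t ?V ?C"
    by (rule unambiguous_trees_singly_rooted[OF permutes_inj[OF t] E])
  note sub = tree_cells_subset[OF T]
  have minV: "Min ?V = 1" using n by (intro Min_eqI) auto
  have maxV: "Max (t ` ?V) = n" using permutes_image[OF t] n by (simp add: Max_eq_iff)
  have memA: "\<exists>w. (x, w) \<in> ?C \<and> x \<in> ?V \<and> w \<in> ?V \<and> y = Suc n - t w" if "(x, y) \<in> ?A" for x y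
    using that sub unfolding mem_point_set by blast
  have root: "x = 1 \<and> Suc n - t w = 1"
    if "(x, w) \<in> ?C" "\<And>x'. (x', w) \<in> ?C \<Longrightarrow> x \<le> x'" "\<And>w'. (x, w') \<in> ?C \<Longrightarrow> t w' \<le> t w" for x w
    using R that unfolding singly_rooted_def minV maxV by fastforce
  show ?thesis
    unfolding nonambiguous_tree_def
  proof (intro conjI ballI impI allI)
    have "finite ?C" using sub by (rule finite_subset) simp
    then show "finite ?A" unfolding point_set_def by simp
    show "fst p > 0" "snd p > 0" if pA: "p \<in> ?A" for p
    proof -
      obtain x y where p: "p = (x, y)" by fastforce
      obtain w where w: "x \<in> ?V" "w \<in> ?V" "y = Suc n - t w" using memA pA p by blast
      show "fst p > 0" "snd p > 0" using w permutes_flip(1)[OF t w(2,2)] p by auto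
    qed
    show "(1, 1) \<in> ?A"
    proof -
      \<comment> \<open>The topmost cell of column 1 has nothing above it and nothing to its left,
        so it must be the corner.\<close>
      let ?W = "{w. (1, w) \<in> ?C}"
      have "?W \<subseteq> ?V" using sub by blast
      then have fin: "finite (t ` ?W)" by (meson finite_atLeastAtMost finite_imageI finite_subset)
      have "1 \<in> ?W" using n unfolding cells_def by simp
      then have "Max (t ` ?W) \<in> t ` ?W" using fin by (intro Max_in) blast+
      then obtain w where w: "(1, w) \<in> ?C" "t w = Max (t ` ?W)" by auto
      have "Suc n - t w = 1"
      proof (rule conjunct2[OF root[OF w(1)]])
        show "1 \<le> x'" if "(x', w) \<in> ?C" for x' using that sub by auto
        show "t w' \<le> t w" if "(1, w') \<in> ?C" for w' unfolding w(2) using fin that by simp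
      qed
      then show ?thesis using w(1) unfolding mem_point_set by metis
    qed
    show "(row_before ?A p \<noteq> {}) \<noteq> (col_before ?A p \<noteq> {})" if pA: "p \<in> ?A" and np: "p \<noteq> (1, 1)" for p
    proof -
      obtain x y where p: "p = (x, y)" by fastforce
      obtain w where w: "(x, w) \<in> ?C" "x \<in> ?V" "w \<in> ?V" "y = Suc n - t w" using memA pA p by blast
      have row: "row_before ?A p \<noteq> {} \<longleftrightarrow> (\<exists>x'. (x', w) \<in> ?C \<and> x' < x)"
        unfolding row_before_def p w(4) using mem_point_set_iff[OF T t w(3)] by fastforce
      have col: "col_before ?A p \<noteq> {} \<longleftrightarrow> (\<exists>w'. (x, w') \<in> ?C \<and> t w < t w')"
      proof
        assume "col_before ?A p \<noteq> {}"
        then obtain y' where y': "(x, y') \<in> ?A" "y' < y" unfolding col_before_def p by fastforce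
        then obtain w' where w': "(x, w') \<in> ?C" "w' \<in> ?V" "y' = Suc n - t w'" using memA by blast
        then have "t w < t w'" using permutes_flip(2)[OF t w'(2) w(3)] y'(2) w(4) by simp
        with w' show "\<exists>w'. (x, w') \<in> ?C \<and> t w < t w'" by blast
      next
        assume "\<exists>w'. (x, w') \<in> ?C \<and> t w < t w'"
        then obtain w' where w': "(x, w') \<in> ?C" "t w < t w'" by blast
        then have "w' \<in> ?V" using sub by blast
        then have "(x, Suc n - t w') \<in> col_before ?A p"
          using mem_point_set_iff[OF T t] w' permutes_flip(2)[OF t _ w(3), of w']
          unfolding col_before_def p w(4) by simp
        then show "col_before ?A p \<noteq> {}" by blast
      qed
      have "\<not> (row_before ?A p \<noteq> {} \<and> col_before ?A p \<noteq> {})"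
        using U w(1) unfolding row col unambiguous_def by (meson not_less)
      moreover have "row_before ?A p \<noteq> {} \<or> col_before ?A p \<noteq> {}"
      proof (rule ccontr)
        assume "\<not> ?thesis"
        then have "x = 1 \<and> Suc n - t w = 1" unfolding row col by (intro root[OF w(1)]) (meson not_less)+
        then show False using np p w(4) by simp
      qed
      ultimately show ?thesis by blast
    qed
    show "\<exists>q \<in> ?A. fst q = x" if pA: "p \<in> ?A" and x: "0 < x \<and> x < fst p" for p x
    proof -
      have "fst p \<in> ?V" using memA[of "fst p" "snd p"] pA by auto
      then have xV: "x \<in> ?V" using x by auto
      then have "(x, x) \<in> ?C" unfolding cells_def by blast
      then have "(x, Suc n - t x) \<in> ?A" unfolding mem_point_set by blast
      then show ?thesis by force
    qed
    show "\<exists>q \<in> ?A. snd q = y" if pA: "p \<in> ?A" and y: "0 < y \<and> y < snd p" for p y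
    proof -
      obtain w where "w \<in> ?V" "snd p = Suc n - t w" using memA[of "fst p" "snd p"] pA by auto
      then have "y < Suc n" using y by linarith
      \<comment> \<open>Row \<open>y\<close> contains the leaf of the column whose tier is
        \<open>Suc n - y\<close>.\<close>
      then have "Suc n - y \<in> t ` ?V" using y permutes_image[OF t] by auto
      then obtain v where v: "v \<in> ?V" "t v = Suc n - y" by (metis imageE)
      then have "(v, v) \<in> ?C" unfolding cells_def by blast
      moreover have "y = Suc n - t v" using v \<open>y < Suc n\<close> by simp
      ultimately have "(v, y) \<in> ?A" unfolding mem_point_set by blast
      then show ?thesis by force
    qed
  qed
qed

lemma point_set_complete:
  assumes n: "n \<ge> 1" and t: "t permutes {1..n}" and E: "E \<in> unambiguous_trees t {1..n}"
  shows "complete_nonambiguous_tree (point_set n (E, t))"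
  unfolding complete_nonambiguous_tree_iff
proof (intro conjI ballI)
  show "nonambiguous_tree (point_set n (E, t))" by (rule point_set_nonambiguous[OF assms])
  fix q assume q: "q \<in> point_set n (E, t)"
  obtain x y where xy: "q = (x, y)" by fastforce
  then obtain w where w: "(x, w) \<in> cells {1..n} E" "y = Suc n - t w"
    using mem_point_set q by blast
  show "row_after (point_set n (E, t)) q = {} \<longleftrightarrow> col_after (point_set n (E, t)) q = {}"
    using point_set_internal[OF _ _ t w(1)] E unfolding xy w(2) by (simp add: unambiguous_trees_def)
qed

text \<open>Internal points are the images of the cells off the diagonal; each edge gives one such
  cell, and a tree on \<open>n\<close> vertices has \<open>n - 1\<close> edges.\<close>

lemma card_internal_point_set:
  assumes n: "n \<ge> 1" and t: "t permutes {1..n}" and E: "E \<in> unambiguous_trees t {1..n}"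
  shows "card (internal_vertices (point_set n (E, t))) = n - 1"
proof -
  let ?V = "{1..n}" and ?A = "point_set n (E, t)"
  have T: "is_tree ?V E" and ti: "tiered E t" using E by (simp_all add: unambiguous_trees_def)
  define D where "D = {(v, w). v < w \<and> {v, w} \<in> E}"
  have D: "D \<subseteq> cells ?V E" unfolding D_def cells_def by blast
  have D_iff: "c \<in> D \<longleftrightarrow> c \<in> cells ?V E \<and> fst c \<noteq> snd c" for c
    unfolding D_def cells_def by (cases c) auto
  have inj: "inj_on (point n t) (cells ?V E)"
  proof (rule inj_onI)
    fix c d assume c: "c \<in> cells ?V E" "d \<in> cells ?V E" "point n t c = point n t d"
    have "snd c \<in> ?V" "snd d \<in> ?V" using c(1,2) tree_cells_subset[OF T] by auto
    then show "c = d" using c(3) permutes_flip(4)[OF t, of "snd c" "snd d"]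
      unfolding point_def by (simp add: case_prod_beta prod_eq_iff)
  qed
  have "internal_vertices ?A = point n t ` D"
  proof -
    let ?I = "{q \<in> ?A. row_after ?A q \<noteq> {}}"
    have I: "point n t c \<in> ?I \<longleftrightarrow> c \<in> D" if c: "c \<in> cells ?V E" for c
    proof -
      obtain x w where xw: "c = (x, w)" by fastforce
      have "point n t c \<in> ?A" using c unfolding point_set_def by simp
      moreover have "row_after ?A (point n t c) \<noteq> {} \<longleftrightarrow> x \<noteq> w"
        using point_set_internal(1)[OF T ti t] c unfolding xw point_def by simp
      ultimately show ?thesis using D_iff[of c] c xw by simp
    qed
    have "?I = point n t ` D"
    proof
      show "?I \<subseteq> point n t ` D"
      proof
        fix q assume q: "q \<in> ?I"
        then have "q \<in> point n t ` cells ?V E" unfolding point_set_def by simp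
        then obtain c where c: "c \<in> cells ?V E" "q = point n t c" by (rule imageE)
        then show "q \<in> point n t ` D" using I[OF c(1)] q by simp
      qed
      show "point n t ` D \<subseteq> ?I" using I D by (intro image_subsetI) (simp only: subset_eq)
    qed
    then show ?thesis
      unfolding internal_vertices_eq[OF point_set_complete[OF assms]] .
  qed
  then have "card (internal_vertices ?A) = card D"
    using card_image[OF inj_on_subset[OF inj D]] by simp
  also have "\<dots> = card E"
  proof (rule bij_betw_same_card[of "\<lambda>(v, w). {v, w}"])
    have "E \<subseteq> (\<lambda>(v, w). {v, w}) ` D"
    proof
      fix e assume e: "e \<in> E"
      then have "card e = 2" using T unfolding is_tree_def by blast
      then obtain a b where "e = {a, b}" "a < b" by (metis card_2_iff insert_commute nat_neq_iff)
      with e have "(a, b) \<in> D" "e = (\<lambda>(v, w). {v, w}) (a, b)" unfolding D_def by auto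
      then show "e \<in> (\<lambda>(v, w). {v, w}) ` D" by blast
    qed
    moreover have "(\<lambda>(v, w). {v, w}) ` D \<subseteq> E" unfolding D_def by auto
    moreover have "inj_on (\<lambda>(v, w). {v, w}) D"
      unfolding D_def by (rule inj_onI) (auto simp: doubleton_eq_iff)
    ultimately show "bij_betw (\<lambda>(v, w). {v, w}) D E" unfolding bij_betw_def by blast
  qed
  also have "\<dots> = n - 1" using card_tree[OF T] by simp
  finally show ?thesis .
qed

text \<open>The last point of column \<open>v\<close> is its leaf, in row
  \<open>Suc n - t v\<close>, so the point set determines \<open>t\<close>. Once \<open>t\<close> is
  known, rows can be translated back into vertices, and the cells determine the edges.\<close>

lemma point_set_inj:
  assumes t: "t permutes {1..n}" "t' permutes {1..n}"
    and E: "E \<in> unambiguous_trees t {1..n}" "E' \<in> unambiguous_trees t' {1..n}"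
    and eq: "point_set n (E, t) = point_set n (E', t')"
  shows "E = E' \<and> t = t'"
proof -
  let ?V = "{1..n}"
  have T: "is_tree ?V E" "is_tree ?V E'" using E by (simp_all add: unambiguous_trees_def)
  have ti: "tiered E t" "tiered E' t'" using E by (simp_all add: unambiguous_trees_def)
  have bound: "y \<le> Suc n - s v"
    if vy: "(v, y) \<in> point_set n (F, s)" and tF: "tiered F s" and TF: "is_tree ?V F" and s: "s permutes ?V" for v y F s
  proof -
    obtain w where w: "(v, w) \<in> cells ?V F" "y = Suc n - s w" using vy unfolding mem_point_set by blast
    then have V: "v \<in> ?V" "w \<in> ?V" using tree_cells_subset[OF TF] by auto
    show ?thesis using permutes_flip(3)[OF s V(2,1)] cells_le(2)[OF tF w(1)] w(2) by simp
  qed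
  have leaf: "(v, Suc n - s v) \<in> point_set n (F, s)" if "v \<in> ?V" for v F s
    unfolding mem_point_set cells_def using that by blast
  have "t v = t' v" for v
  proof (cases "v \<in> ?V")
    case True
    have "Suc n - t v \<le> Suc n - t' v" "Suc n - t' v \<le> Suc n - t v"
      using leaf[OF True, of t E] leaf[OF True, of t' E'] bound[OF _ ti(1) T(1) t(1)]
        bound[OF _ ti(2) T(2) t(2)] unfolding eq by blast+
    moreover have "t v \<in> ?V" "t' v \<in> ?V" using t True permutes_in_image by metis+
    ultimately show ?thesis by auto
  next
    case False
    then show ?thesis using t by (simp add: permutes_not_in)
  qed
  then have tt: "t = t'" by blast
  have "(x, w) \<in> cells ?V E \<longleftrightarrow> (x, w) \<in> cells ?V E'" for x w
  proof (cases "w \<in> ?V")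
    case True
    show ?thesis
      using mem_point_set_iff[OF T(1) t(1) True, of x] mem_point_set_iff[OF T(2) t(2) True, of x] eq
      unfolding tt by simp
  next
    case False
    then show ?thesis using T tree_cells_subset by blast
  qed
  then have cc: "cells ?V E = cells ?V E'" by auto
  have sub: "F \<subseteq> F'" if F: "is_tree ?V F" "cells ?V F = cells ?V F'" for F F'
  proof
    fix e assume e: "e \<in> F"
    then have "card e = 2" using F(1) unfolding is_tree_def by blast
    then obtain a b where ab: "e = {a, b}" "a < b" by (metis card_2_iff insert_commute nat_neq_iff)
    then have "(a, b) \<in> cells ?V F" using e unfolding cells_def by blast
    then have "(a, b) \<in> cells ?V F'" unfolding F(2) .
    then show "e \<in> F'" using ab unfolding cells_def by auto
  qed
  show ?thesis using sub[OF T(1) cc] sub[OF T(2) cc[symmetric]] tt by blast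
qed

section \<open>Reading a tree off a complete nonambiguous tree\<close>

lemma downward_closed_interval:
  fixes S :: "nat set"
  assumes "finite S" "S \<noteq> {}" "\<And>x. x \<in> S \<Longrightarrow> 0 < x" "\<And>x y. x \<in> S \<Longrightarrow> 0 < y \<Longrightarrow> y < x \<Longrightarrow> y \<in> S"
  shows "S = {1..Max S}"
proof
  show "S \<subseteq> {1..Max S}" using assms(1,3) by (auto simp: Suc_le_eq)
  show "{1..Max S} \<subseteq> S"
  proof
    fix y assume y: "y \<in> {1..Max S}"
    have "Max S \<in> S" using assms(1,2) by simp
    then show "y \<in> S" using assms(4)[of "Max S" y] y by (cases "y = Max S") auto
  qed
qed

text \<open>The map from a column to the row of its last point and the map from a row to the column
  of its last point are mutually inverse. Hence there are as many rows as columns, and the last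
  points form the graph of a permutation \<open>r\<close>.\<close>

lemma complete_nonambiguous_tree_leaves:
  assumes A: "complete_nonambiguous_tree A"
  obtains m r where "m \<ge> 1" "r permutes {1..m}" "A \<subseteq> {1..m} \<times> {1..m}"
    "\<And>x. x \<in> {1..m} \<Longrightarrow> (x, r x) \<in> A"
    "\<And>x y. (x, y) \<in> A \<Longrightarrow> y \<le> r x"
    "\<And>x x'. x' \<in> {1..m} \<Longrightarrow> (x, r x') \<in> A \<Longrightarrow> x \<le> x'"
proof -
  have fin: "finite A" and pos: "\<And>p. p \<in> A \<Longrightarrow> fst p > 0 \<and> snd p > 0" and root: "(1, 1) \<in> A"
    and X: "\<And>p x. p \<in> A \<Longrightarrow> 0 < x \<Longrightarrow> x < fst p \<Longrightarrow> \<exists>q \<in> A. fst q = x"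
    and Y: "\<And>p y. p \<in> A \<Longrightarrow> 0 < y \<Longrightarrow> y < snd p \<Longrightarrow> \<exists>q \<in> A. snd q = y"
    and RC: "\<And>q. q \<in> A \<Longrightarrow> row_after A q = {} \<longleftrightarrow> col_after A q = {}"
    using A unfolding complete_nonambiguous_tree_iff nonambiguous_tree_def by auto
  define m where "m = Max (fst ` A)"
  define k where "k = Max (snd ` A)"
  have ne: "fst ` A \<noteq> {}" "snd ` A \<noteq> {}" using root by auto
  have fX: "fst ` A = {1..m}" unfolding m_def
  proof (rule downward_closed_interval)
    show "y \<in> fst ` A" if x: "x \<in> fst ` A" and y: "0 < y" "y < x" for x y
    proof -
      obtain p where "p \<in> A" "x = fst p" using x by blast
      then obtain q where "q \<in> A" "fst q = y" using X[of p y] y by blast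
      then show ?thesis by blast
    qed
    show "0 < x" if "x \<in> fst ` A" for x using pos that by blast
  qed (use fin ne in simp_all)
  have fY: "snd ` A = {1..k}" unfolding k_def
  proof (rule downward_closed_interval)
    show "y \<in> snd ` A" if x: "x \<in> snd ` A" and y: "0 < y" "y < x" for x y
    proof -
      obtain p where "p \<in> A" "x = snd p" using x by blast
      then obtain q where "q \<in> A" "snd q = y" using Y[of p y] y by blast
      then show ?thesis by blast
    qed
    show "0 < x" if "x \<in> snd ` A" for x using pos that by blast
  qed (use fin ne in simp_all)
  define R where "R x = Max {y. (x, y) \<in> A}" for x
  define L where "L y = Max {x. (x, y) \<in> A}" for y
  have finR: "finite {y. (x, y) \<in> A}" for x
  proof (rule finite_subset)
    show "{y. (x, y) \<in> A} \<subseteq> snd ` A" by force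
  qed (use fin in simp)
  have finL: "finite {x. (x, y) \<in> A}" for y
  proof (rule finite_subset)
    show "{x. (x, y) \<in> A} \<subseteq> fst ` A" by force
  qed (use fin in simp)
  have R_le: "y \<le> R x" if "(x, y) \<in> A" for x y unfolding R_def using finR that by simp
  have L_le: "x \<le> L y" if "(x, y) \<in> A" for x y unfolding L_def using finL that by simp
  have R_in: "(x, R x) \<in> A" if "x \<in> {1..m}" for x
  proof -
    have "x \<in> fst ` A" using fX that by simp
    then have "{y. (x, y) \<in> A} \<noteq> {}" by force
    then show ?thesis using Max_in[OF finR] unfolding R_def by blast
  qed
  have L_in: "(L y, y) \<in> A" if "y \<in> {1..k}" for y
  proof -
    have "y \<in> snd ` A" using fY that by simp
    then have "{x. (x, y) \<in> A} \<noteq> {}" by force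
    then show ?thesis using Max_in[OF finL] unfolding L_def by blast
  qed
  have Rk: "R x \<in> {1..k}" if "x \<in> {1..m}" for x
  proof -
    have "R x \<in> snd ` A" using R_in[OF that] by force
    then show ?thesis using fY by simp
  qed
  have Lm: "L y \<in> {1..m}" if "y \<in> {1..k}" for y
  proof -
    have "L y \<in> fst ` A" using L_in[OF that] by force
    then show ?thesis using fX by simp
  qed
  \<comment> \<open>By completeness the last point of a column is also the last point of its row.\<close>
  have LR: "L (R x) = x" if x: "x \<in> {1..m}" for x
  proof -
    have "col_after A (x, R x) = {}" using R_le unfolding col_after_def by force
    then have "row_after A (x, R x) = {}" using RC[OF R_in[OF x]] by simp
    then have "\<not> x < L (R x)" using L_in[OF Rk[OF x]] unfolding row_after_def by force
    then show ?thesis using L_le[OF R_in[OF x]] by simp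
  qed
  have RL: "R (L y) = y" if y: "y \<in> {1..k}" for y
  proof -
    have "row_after A (L y, y) = {}" using L_le unfolding row_after_def by force
    then have "col_after A (L y, y) = {}" using RC[OF L_in[OF y]] by simp
    then have "\<not> y < R (L y)" using R_in[OF Lm[OF y]] unfolding col_after_def by force
    then show ?thesis using R_le[OF L_in[OF y]] by simp
  qed
  have bij: "bij_betw R {1..m} {1..k}"
    by (rule bij_betw_byWitness[where f' = L]) (use LR RL Rk Lm in auto)
  then have mk: "m = k" using bij_betw_same_card by fastforce
  \<comment> \<open>The identity outside \<open>{1..m}\<close> is what \<open>permutes\<close>
    demands.\<close>
  define r where "r x = (if x \<in> {1..m} then R x else x)" for x
  have rR: "r x = R x" if "x \<in> {1..m}" for x using that by (simp add: r_def)
  have fstm: "x \<in> {1..m}" "y \<in> {1..m}" if "(x, y) \<in> A" for x y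
  proof -
    have "x \<in> fst ` A" "y \<in> snd ` A" using that by force+
    then show "x \<in> {1..m}" "y \<in> {1..m}" using fX fY mk by simp_all
  qed
  show thesis
  proof (rule that)
    show "m \<ge> 1" using fstm(1)[OF root] by simp
    show "r permutes {1..m}"
    proof (rule bij_imp_permutes)
      show "bij_betw r {1..m} {1..m}"
        using bij mk rR bij_betw_cong[of "{1..m}" r R "{1..m}"] by simp
      show "r x = x" if "x \<notin> {1..m}" for x using that by (simp only: r_def if_False)
    qed
    show "A \<subseteq> {1..m} \<times> {1..m}" using fstm by auto
    show "(x, r x) \<in> A" if "x \<in> {1..m}" for x using R_in[OF that] rR[OF that] by simp
    show "y \<le> r x" if "(x, y) \<in> A" for x y using R_le[OF that] rR[OF fstm(1)[OF that]] by simp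
    show "x \<le> x'" if "x' \<in> {1..m}" "(x, r x') \<in> A" for x x'
      using L_le[OF that(2)] rR[OF that(1)] LR[OF that(1)] by simp
  qed
qed

text \<open>\<open>t\<close> reverses \<open>r\<close>, and each point that is not a leaf becomes an
  edge. The size \<open>m\<close> is not prescribed here; it is identified later by counting
  internal points.\<close>

lemma point_set_surj:
  assumes A: "complete_nonambiguous_tree A"
  obtains m t E where "m \<ge> 1" "t permutes {1..m}" "E \<in> unambiguous_trees t {1..m}"
    "A = point_set m (E, t)"
proof -
  obtain m r where m: "m \<ge> 1" and r: "r permutes {1..m}" and AV: "A \<subseteq> {1..m} \<times> {1..m}"
    and leaf: "\<And>x. x \<in> {1..m} \<Longrightarrow> (x, r x) \<in> A"
    and col: "\<And>x y. (x, y) \<in> A \<Longrightarrow> y \<le> r x"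
    and row: "\<And>x x'. x' \<in> {1..m} \<Longrightarrow> (x, r x') \<in> A \<Longrightarrow> x \<le> x'"
    using complete_nonambiguous_tree_leaves[OF A] by metis
  let ?V = "{1..m}"
  have xor: "\<And>p. p \<in> A \<Longrightarrow> p \<noteq> (1, 1) \<Longrightarrow> (row_before A p \<noteq> {}) \<noteq> (col_before A p \<noteq> {})"
    using A unfolding complete_nonambiguous_tree_def nonambiguous_tree_def by blast
  have rV: "r x \<in> ?V" if "x \<in> ?V" for x using permutes_in_image[OF r] that by simp
  have r_inj: "x = y" if "r x = r y" for x y using permutes_inj[OF r] that by (simp add: inj_eq)
  have row_ex: "\<exists>w \<in> ?V. y = r w" if "y \<in> ?V" for y using permutes_image[OF r] that by (metis imageE)
  define t where "t x = (if x \<in> ?V then Suc m - r x else x)" for x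
  have tV: "t x = Suc m - r x" if "x \<in> ?V" for x using that by (simp add: t_def)
  have rt: "Suc m - t x = r x" if "x \<in> ?V" for x using tV[OF that] rV[OF that] by auto
  have t: "t permutes ?V"
  proof (rule bij_imp_permutes)
    have "inj_on t ?V"
    proof (rule inj_onI)
      fix x y assume "x \<in> ?V" "y \<in> ?V" "t x = t y"
      then have "r x = r y" using rt by metis
      then show "x = y" by (rule r_inj)
    qed
    moreover have "t ` ?V \<subseteq> ?V" using tV rV by fastforce
    ultimately show "bij_betw t ?V ?V" by (simp add: bij_betw_def endo_inj_surj)
    show "t x = x" if "x \<notin> ?V" for x using that by (simp only: t_def if_False)
  qed
  have t_less: "t x < t y \<longleftrightarrow> r y < r x" if "x \<in> ?V" "y \<in> ?V" for x y
    using tV rV[OF that(1)] rV[OF that(2)] that by auto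
  define E where "E = {{x, w} |x w. x \<in> ?V \<and> w \<in> ?V \<and> x < w \<and> (x, r w) \<in> A}"
  have E_iff: "{x, w} \<in> E \<longleftrightarrow> x \<in> ?V \<and> w \<in> ?V \<and> (x, r w) \<in> A" if "x < w" for x w
  proof
    show "x \<in> ?V \<and> w \<in> ?V \<and> (x, r w) \<in> A" if "{x, w} \<in> E"
      using that \<open>x < w\<close> unfolding E_def by (auto simp: doubleton_eq_iff)
    show "{x, w} \<in> E" if "x \<in> ?V \<and> w \<in> ?V \<and> (x, r w) \<in> A"
      using that \<open>x < w\<close> unfolding E_def by blast
  qed
  have C_iff: "(x, w) \<in> cells ?V E \<longleftrightarrow> x \<in> ?V \<and> w \<in> ?V \<and> (x, r w) \<in> A" for x w
  proof
    assume "(x, w) \<in> cells ?V E"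
    then show "x \<in> ?V \<and> w \<in> ?V \<and> (x, r w) \<in> A"
      unfolding cells_def using E_iff leaf by blast
  next
    assume xw: "x \<in> ?V \<and> w \<in> ?V \<and> (x, r w) \<in> A"
    then have "x \<le> w" using row by blast
    then have "x = w \<or> x < w" by auto
    then show "(x, w) \<in> cells ?V E" using xw E_iff unfolding cells_def by blast
  qed
  have A_eq: "A = point_set m (E, t)"
  proof (rule set_eqI)
    fix p :: "nat \<times> nat"
    obtain x y where p: "p = (x, y)" by fastforce
    have "(x, y) \<in> A \<longleftrightarrow> (\<exists>w. x \<in> ?V \<and> w \<in> ?V \<and> (x, r w) \<in> A \<and> y = r w)"
      using AV row_ex by blast
    also have "\<dots> \<longleftrightarrow> (x, y) \<in> point_set m (E, t)"
      unfolding mem_point_set C_iff using rt by metis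
    finally show "p \<in> A \<longleftrightarrow> p \<in> point_set m (E, t)" unfolding p .
  qed
  have edges: "e \<subseteq> ?V \<and> card e = 2" if "e \<in> E" for e
    using that unfolding E_def by (auto simp: card_2_iff)
  have ti: "tiered E t"
    unfolding tiered_def
  proof (intro allI impI)
    fix u v assume uv: "{u, v} \<in> E \<and> u > v"
    then have "{v, u} \<in> E" by (simp add: insert_commute)
    then have v: "v \<in> ?V" "u \<in> ?V" "(v, r u) \<in> A" using uv E_iff by simp_all
    have "r u \<noteq> r v" using r_inj uv by blast
    then have "r u < r v" using col[OF v(3)] by simp
    then show "t u > t v" using t_less v by simp
  qed
  have U: "unambiguous t (cells ?V E)"
    unfolding unambiguous_def C_iff
  proof (intro allI impI)
    fix x y x' y'
    assume as: "(x \<in> ?V \<and> y \<in> ?V \<and> (x, r y) \<in> A) \<and> (x' \<in> ?V \<and> y \<in> ?V \<and> (x', r y) \<in> A) \<and> x' < x \<and>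
      (x \<in> ?V \<and> y' \<in> ?V \<and> (x, r y') \<in> A)"
    have "(x', r y) \<in> row_before A (x, r y)" using as unfolding row_before_def by simp
    \<comment> \<open>Here \<open>x' < x\<close> with \<open>x'\<close> positive, so the point is
      not the root and the exclusive condition applies.\<close>
    moreover have "(x, r y) \<noteq> (1, 1)" using as by auto
    ultimately have "col_before A (x, r y) = {}" using xor as by blast
    then have "\<not> r y' < r y" using as unfolding col_before_def by auto
    then show "t y' \<le> t y" using t_less[of y y'] as by simp
  qed
  have "is_tree ?V E"
    unfolding is_tree_def
  proof (intro conjI ballI)
    show "finite ?V" "?V \<noteq> {}" using m by auto
    show "e \<subseteq> ?V" "card e = 2" if "e \<in> E" for e using edges[OF that] by simp_all
    show "\<nexists>vs. is_cycle E vs" by (rule acyclic_if_unambiguous[OF permutes_inj[OF t] edges ti U])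
    \<comment> \<open>The points of a row form a star: the column of each is that of the leaf or is
      joined to it by an edge.\<close>
    have row_connected: "(w, x) \<in> (adj_on ?V E)\<^sup>*" if "(x, r w) \<in> A" "w \<in> ?V" for x w
    proof -
      have "x = w \<or> x < w" using row[OF that(2,1)] by auto
      then show ?thesis
      proof
        assume "x < w"
        moreover have "x \<in> ?V" using AV that(1) by blast
        ultimately have "(w, x) \<in> adj_on ?V E"
          using E_iff[of x w] that by (simp add: adj_on_def insert_commute)
        then show ?thesis by blast
      qed simp
    qed
    \<comment> \<open>Predecessors are followed down to the root. A step up keeps the column, hence
      the vertex; a step to the left passes through the leaf of the common row.\<close>
    have to_root: "(x, 1) \<in> (adj_on ?V E)\<^sup>*" if "(x, y) \<in> A" for x y
      using that
    proof (induction "x + y" arbitrary: x y rule: less_induct)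
      case less
      show ?case
      proof (cases "(x, y) = (1, 1)")
        case False
        then consider "row_before A (x, y) \<noteq> {}" | "col_before A (x, y) \<noteq> {}" using xor[OF less.prems] by blast
        then show ?thesis
        proof cases
          case 1
          then obtain x' where x': "(x', y) \<in> A" "x' < x" unfolding row_before_def by fastforce
          then have IH: "(x', 1) \<in> (adj_on ?V E)\<^sup>*" using less.hyps[OF _ x'(1)] by simp
          have "y \<in> ?V" using AV less.prems by blast
          then obtain w where w: "w \<in> ?V" "y = r w" using row_ex by blast
          then have xw: "(x, r w) \<in> A" "(x', r w) \<in> A" using less.prems x'(1) by simp_all
          have "(x, w) \<in> (adj_on ?V E)\<^sup>*"
            by (rule adj_on_rtrancl_sym[OF row_connected[OF xw(1) w(1)]])
          moreover have "(w, x') \<in> (adj_on ?V E)\<^sup>*" by (rule row_connected[OF xw(2) w(1)])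
          ultimately show ?thesis using IH by (meson rtrancl_trans)
        next
          case 2
          then obtain y' where y': "(x, y') \<in> A" "y' < y" unfolding col_before_def by fastforce
          then show ?thesis using less.hyps[OF _ y'(1)] by simp
        qed
      qed simp
    qed
    show "(u, v) \<in> (adj_on ?V E)\<^sup>*" if "u \<in> ?V" "v \<in> ?V" for u v
      using to_root[OF leaf[OF that(1)]] adj_on_rtrancl_sym[OF to_root[OF leaf[OF that(2)]]]
      by (rule rtrancl_trans)
  qed
  then have "E \<in> unambiguous_trees t ?V" using ti U by (simp add: unambiguous_trees_def)
  with m t show thesis using A_eq by (rule that)
qed

lemma bij_betw_point_set:
  assumes n: "n \<ge> 1"
  shows "bij_betw (point_set n) {(E, t). t permutes {1..n} \<and> E \<in> unambiguous_trees t {1..n}}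
    {A. complete_nonambiguous_tree A \<and> card (internal_vertices A) = n - 1}"
    (is "bij_betw _ ?S ?N")
  unfolding bij_betw_def
proof
  show "inj_on (point_set n) ?S"
  proof (rule inj_onI)
    fix p q assume p: "p \<in> ?S" and q: "q \<in> ?S" and eq: "point_set n p = point_set n q"
    obtain E t E' t' where "p = (E, t)" "q = (E', t')" by fastforce
    with p q eq show "p = q" using point_set_inj[of t n t' E E'] by simp
  qed
  show "point_set n ` ?S = ?N"
  proof
    show "point_set n ` ?S \<subseteq> ?N"
      using point_set_complete[OF n] card_internal_point_set[OF n] by auto
    show "?N \<subseteq> point_set n ` ?S"
    proof
      fix A assume A: "A \<in> ?N"
      then have "complete_nonambiguous_tree A" by simp
      then obtain m t E where mtE: "m \<ge> 1" "t permutes {1..m}" "E \<in> unambiguous_trees t {1..m}"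
        "A = point_set m (E, t)" by (rule point_set_surj)
      \<comment> \<open>Both sizes are at least 1, so the truncated differences determine
        them.\<close>
      then have "m - 1 = n - 1" using A card_internal_point_set by fastforce
      then have "m = n" using n mtE(1) by simp
      then show "A \<in> point_set n ` ?S" using mtE by blast
    qed
  qed
qed

theorem theorem5p1:
  fixes n :: nat
  assumes "n \<ge> 1"
  shows "\<exists>f. bij_betw f
           {(E, t). fully_tiered_tree n E t \<and> weight E t {1..n} = 0}
           {A. complete_nonambiguous_tree A \<and> card (internal_vertices A) = n - 1}"
proof -
  let ?V = "{1..n}"
  \<comment> \<open>Pairing with \<open>t\<close> turns the equalities for the single tierings into
    one equality of sums over all permutations.\<close>
  define S where "S G = {(E, t). t permutes ?V \<and> E \<in> G t ?V}"
    for G :: "(nat \<Rightarrow> nat) \<Rightarrow> nat set \<Rightarrow> nat set set set"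
  have S: "finite (S G) \<and> card (S G) = (\<Sum>t | t permutes ?V. card (G t ?V))"
    if fin: "\<And>t. t permutes ?V \<Longrightarrow> finite (G t ?V)" for G
  proof -
    let ?T = "SIGMA t:{t. t permutes ?V}. G t ?V"
    have "S G = prod.swap ` ?T" unfolding S_def by force
    moreover have perms: "finite {t. t permutes ?V}" by (simp add: finite_permutations)
    have "finite ?T" using perms fin by (intro finite_SigmaI) auto
    moreover have "card ?T = (\<Sum>t | t permutes ?V. card (G t ?V))"
      using perms fin by (intro card_SigmaI) auto
    ultimately show ?thesis by (simp add: card_image)
  qed
  have V: "finite ?V" "?V \<noteq> {}" using assms by auto
  have rec: "recursive_trees t (\<lambda>_ B. inv_into B t (Max (t ` B))) (unambiguous_trees t)"
    if "t permutes ?V" for t by (rule recursive_unambiguous_trees[OF permutes_inj[OF that]])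
  have fin: "finite (weight_zero_trees t ?V)" "finite (unambiguous_trees t ?V)" if "t permutes ?V" for t
    using finite_recursive_trees[OF recursive_weight_zero_trees] finite_recursive_trees[OF rec[OF that]]
    by blast+
  have "card (weight_zero_trees t ?V) = card (unambiguous_trees t ?V)" if "t permutes ?V" for t
    by (rule recursive_trees_same_card[OF recursive_weight_zero_trees rec[OF that] V])
  then have "card (S weight_zero_trees) = card (S unambiguous_trees)"
    using S[of weight_zero_trees] S[of unambiguous_trees] fin by simp
  moreover have "finite (S weight_zero_trees)" "finite (S unambiguous_trees)"
    using S fin by simp_all
  \<comment> \<open>Any bijection between finite sets of equal size serves; nothing requires
    \<open>g\<close> to preserve the tiering.\<close>
  ultimately obtain g where g: "bij_betw g (S weight_zero_trees) (S unambiguous_trees)"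
    using finite_same_card_bij by blast
  have eq: "S weight_zero_trees = {(E, t). fully_tiered_tree n E t \<and> weight E t ?V = 0}"
    unfolding S_def weight_zero_trees_def fully_tiered_tree_def tiered_def by auto
  have "bij_betw (point_set n \<circ> g) (S weight_zero_trees)
      {A. complete_nonambiguous_tree A \<and> card (internal_vertices A) = n - 1}"
    using bij_betw_trans[OF g] bij_betw_point_set[OF assms] unfolding S_def by blast
  then show ?thesis unfolding eq by blast
qed

end
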